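(* Let $\mathbf g=(g_1,\dots,g_s)$ and suppose that the Krull dimension of $\mathbb R[\mathbf X]/\operatorname{supp}\mathcal Q(\mathbf g)$ is $0$. Then $S=\mathcal S(\mathbf g)=\{\xi_1,\dots,\xi_r\}$ is non-empty and finite, and, with $\rho=\rho(\xi_1,\dots,\xi_r)$, there exists $d\in\mathbb N$ such that for all $k\in\mathbb N$: $$\mathcal L_{d+k}(\mathbf g)^{[2(\rho-1)+k]}=\operatorname{cone}(\mathbf e_{\xi_1},\dots,\mathbf e_{\xi_r})^{[2(\rho-1)+k]}.$$
   Context: $\mathbb R[\mathbf X]=\mathbb R[X_1,\dots,X_n]$, $\mathbb R[\mathbf X]_t$ polynomials of degree $\le t$; $\Sigma^2$ sums of squares, $\Sigma^2_t=\Sigma^2\cap\mathbb R[\mathbf X]_t$. $\mathcal Q_t(\mathbf g)=\{s_0+\sum_j s_jg_j: s_0\in\Sigma^2_t, s_j\in\Sigma^2,\deg s_j\le t-\deg g_j\}$, $\mathcal Q(\mathbf g)=\bigcup_t\mathcal Q_t(\mathbf g)$, $\operatorname{supp}Q=Q\cap(-Q)$. $\mathcal L_t(\mathbf g)=\{\sigma\in(\mathbb R[\mathbf X]_t)^*:\sigma(q)\ge 0\ \forall q\in\mathcal Q_t(\mathbf g)\}$. $\mathcal S(\mathbf g)=\{x\in\mathbb R^n:g_j(x)\ge0\ \forall j\}$. $\mathbf e_\xi$ is evaluation at $\xi$; $\sigma^{[t]}$ denotes restriction of a functional to $\mathbb R[\mathbf X]_t$ and $B^{[t]}=\{\sigma^{[t]}:\sigma\in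 B\}$; $\operatorname{cone}$ denotes the generated convex cone. For a finite set $\Xi\subset\mathbb R^n$, $\rho(\Xi)$ is the Castelnuovo–Mumford regularity of its vanishing ideal $\mathcal I(\Xi)$; it is a standard fact that $\mathcal I(\Xi)$ has a graded basis of degree $\le\rho(\Xi)$ and that there are interpolation polynomials $u_i$ ($u_i(\xi_j)=\delta_{ij}$) of degree $\le\rho(\Xi)-1$. *)

theory Defs
  imports Complex_Main "HOL-Library.Poly_Mapping"
begin

type_synonym 'n mpoly = "('n \<Rightarrow>\<^sub>0 nat) \<Rightarrow>\<^sub>0 real"

definition mconst :: "real \<Rightarrow> 'n mpoly" where
  "mconst c = Poly_Mapping.single 0 c"

definition mvar :: "'n \<Rightarrow> 'n mpoly" where
  "mvar i = Poly_Mapping.single (Poly_Mapping.single i 1) 1"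

text \<open>Total degree (degree of the zero polynomial is taken to be 0).\<close>
definition tdeg :: "'n mpoly \<Rightarrow> nat" where
  "tdeg p = Max (insert 0 ((\<lambda>m. \<Sum>i\<in>Poly_Mapping.keys m. Poly_Mapping.lookup m i) ` Poly_Mapping.keys p))"

definition meval :: "'n mpoly \<Rightarrow> ('n \<Rightarrow> real) \<Rightarrow> real" where
  "meval p x = (\<Sum>m\<in>Poly_Mapping.keys p.
       Poly_Mapping.lookup p m * (\<Prod>i\<in>Poly_Mapping.keys m. x i ^ Poly_Mapping.lookup m i))"

definition sos :: "'n mpoly \<Rightarrow> bool" where
  "sos p \<longleftrightarrow> (\<exists>qs. p = sum_list (map (\<lambda>q. q * q) qs))"

definition sos_t :: "nat \<Rightarrow> 'n mpoly set" where
  "sos_t t = {p. sos p \<and> tdeg p \<le> t}"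

text \<open>Truncated quadratic module Q_t(g) for g = [g_1,...,g_s]:
  s_0 + \<Sum>_j s_j g_j with s_0 \<in> \<Sigma>^2_t and s_j \<in> \<Sigma>^2 with deg s_j \<le> t - deg g_j
  (if deg g_j > t this forces s_j = 0).\<close>
definition qmod_t :: "'n mpoly list \<Rightarrow> nat \<Rightarrow> 'n mpoly set" where
  "qmod_t g t = {p. \<exists>s0 s. s0 \<in> sos_t t \<and>
      (\<forall>j<length g. sos (s j) \<and> (s j = 0 \<or> tdeg (s j) + tdeg (g ! j) \<le> t)) \<and>
      p = s0 + (\<Sum>j<length g. s j * g ! j)}"

definition qmod :: "'n mpoly list \<Rightarrow> 'n mpoly set" where
  "qmod g = (\<Union>t. qmod_t g t)"

definition supp_qm :: "'n mpoly set \<Rightarrow> 'n mpoly set" where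
  "supp_qm Q = {p. p \<in> Q \<and> - p \<in> Q}"

definition semialg :: "'n mpoly list \<Rightarrow> ('n \<Rightarrow> real) set" where
  "semialg g = {x. \<forall>j<length g. meval (g ! j) x \<ge> 0}"

definition is_ideal :: "'n mpoly set \<Rightarrow> bool" where
  "is_ideal I \<longleftrightarrow> 0 \<in> I \<and> (\<forall>a\<in>I. \<forall>b\<in>I. a + b \<in> I) \<and> (\<forall>a\<in>I. \<forall>r. r * a \<in> I)"

definition is_prime_ideal :: "'n mpoly set \<Rightarrow> bool" where
  "is_prime_ideal P \<longleftrightarrow> is_ideal P \<and> 1 \<notin> P \<and> (\<forall>a b. a * b \<in> P \<longrightarrow> a \<in> P \<or> b \<in> P)"

text \<open>Lengths m of chains P_0 \<subset> ... \<subset> P_m of prime ideals of R[X]/I, i.e. prime ideals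
  of R[X] containing I.  Krull dimension of R[X]/I is the supremum of these lengths
  (and is -\<infinity> if there are none); it is 0 iff the set of lengths is exactly {0}.\<close>
definition prime_chain_lengths :: "'n mpoly set \<Rightarrow> nat set" where
  "prime_chain_lengths I = {m. \<exists>P :: nat \<Rightarrow> 'n mpoly set.
      (\<forall>i\<le>m. is_prime_ideal (P i) \<and> I \<subseteq> P i) \<and> (\<forall>i<m. P i \<subset> P (Suc i))}"

definition krull_dim_quot_zero :: "'n mpoly set \<Rightarrow> bool" where
  "krull_dim_quot_zero I \<longleftrightarrow> prime_chain_lengths I = {0}"

text \<open>Functionals on R[X]_t are represented canonically as functions on all polynomials
  which vanish outside R[X]_t.\<close>
definition restr :: "nat \<Rightarrow> ('n mpoly \<Rightarrow> real) \<Rightarrow> ('n mpoly \<Rightarrow> real)" where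
  "restr t \<sigma> = (\<lambda>p. if tdeg p \<le> t then \<sigma> p else 0)"

definition lin_functional_t :: "nat \<Rightarrow> ('n mpoly \<Rightarrow> real) \<Rightarrow> bool" where
  "lin_functional_t t \<sigma> \<longleftrightarrow>
     (\<forall>p q. tdeg p \<le> t \<longrightarrow> tdeg q \<le> t \<longrightarrow> \<sigma> (p + q) = \<sigma> p + \<sigma> q) \<and>
     (\<forall>c p. tdeg p \<le> t \<longrightarrow> \<sigma> (mconst c * p) = c * \<sigma> p) \<and>
     (\<forall>p. \<not> tdeg p \<le> t \<longrightarrow> \<sigma> p = 0)"

definition Lt :: "'n mpoly list \<Rightarrow> nat \<Rightarrow> ('n mpoly \<Rightarrow> real) set" where
  "Lt g t = {\<sigma>. lin_functional_t t \<sigma> \<and> (\<forall>q\<in>qmod_t g t. \<sigma> q \<ge> 0)}"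

definition restr_set :: "nat \<Rightarrow> ('n mpoly \<Rightarrow> real) set \<Rightarrow> ('n mpoly \<Rightarrow> real) set" where
  "restr_set t B = restr t ` B"

definition eval_cone :: "('n \<Rightarrow> real) set \<Rightarrow> ('n mpoly \<Rightarrow> real) set" where
  "eval_cone \<Xi> = {(\<lambda>p. \<Sum>\<xi>\<in>\<Xi>. c \<xi> * meval p \<xi>) | c. \<forall>\<xi>\<in>\<Xi>. c \<xi> \<ge> 0}"

text \<open>Castelnuovo-Mumford regularity of the vanishing ideal of a finite point set \<Xi>:
  \<rho>(\<Xi>) = 1 + the least t such that polynomials of degree \<le> t interpolate arbitrary
  values on \<Xi> (i.e. the Hilbert function of I(\<Xi>) reaches |\<Xi>| at t).\<close>
definition interp_deg :: "('n \<Rightarrow> real) set \<Rightarrow> nat" where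
  "interp_deg \<Xi> = (LEAST t. \<forall>f :: ('n \<Rightarrow> real) \<Rightarrow> real.
      \<exists>p. tdeg p \<le> t \<and> (\<forall>\<xi>\<in>\<Xi>. meval p \<xi> = f \<xi>))"

definition cm_reg :: "('n \<Rightarrow> real) set \<Rightarrow> nat" where
  "cm_reg \<Xi> = interp_deg \<Xi> + 1"

end

theory Submission
  imports Defs "HOL-Library.FuncSet" "HOL-Analysis.Continuum_Not_Denumerable"
    "HOL-Computational_Algebra.Fundamental_Theorem_Algebra"
begin

text \<open>
  Write \<open>I\<close> for the support of \<open>\<Q>(g)\<close>.  It is an ideal, and two facts about it suffice.
  (1) For each variable, \<open>I\<close> contains a nonzero univariate polynomial: otherwise a prime above \<open>I\<close>
  avoids all of them, is maximal because the dimension is zero, and contradicts Zariski's lemma.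
  (2) If \<open>h\<close> vanishes on \<open>S\<close>, some power of \<open>h\<close> lies in \<open>I\<close>: otherwise a prime above \<open>I\<close> avoids
  \<open>h\<close> and all \<open>c + v\<close> with \<open>c > 0\<close> and \<open>v\<close> in \<open>\<Q>(g)\<close>, and such a prime is the ideal of a point of \<open>S\<close>.

  Let the \<open>u\<^sub>\<xi>\<close> interpolate on \<open>S\<close> in degree at most \<open>\<rho> - 1\<close>.  A functional \<open>\<sigma>\<close> nonnegative on the truncated
  quadratic module annihilates \<open>p - \<Sum>\<^sub>\<xi> p(\<xi>) u\<^sub>\<xi>\<close>: the univariate elements of \<open>I\<close> rewrite every monomial
  into monomials of bounded degree, and for those (2) and the Cauchy-Schwarz
  argument \<open>\<sigma>(h\<^sup>2) = 0 \<Longrightarrow> \<sigma>(h) = 0\<close> apply.  Hence \<open>\<sigma>(p) = \<Sum>\<^sub>\<xi> \<sigma>(u\<^sub>\<xi>) p(\<xi>)\<close>, and \<open>p = u\<^sub>\<xi>\<^sup>2\<close>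
  gives \<open>\<sigma>(u\<^sub>\<xi>) \<ge> 0\<close>.
\<close>

subsection \<open>Degrees and evaluation\<close>

abbreviation mon :: "('n \<Rightarrow>\<^sub>0 nat) \<Rightarrow> 'n mpoly" where
  "mon m \<equiv> Poly_Mapping.single m 1"

definition mdeg :: "('n \<Rightarrow>\<^sub>0 nat) \<Rightarrow> nat" where
  "mdeg m = (\<Sum>i\<in>Poly_Mapping.keys m. Poly_Mapping.lookup m i)"

definition mon_eval :: "('n \<Rightarrow>\<^sub>0 nat) \<Rightarrow> ('n \<Rightarrow> real) \<Rightarrow> real" where
  "mon_eval m x = (\<Prod>i\<in>Poly_Mapping.keys m. x i ^ Poly_Mapping.lookup m i)"

text \<open>Summing over all variables removes the dependence on the support, so additivity in the
  exponent becomes immediate.\<close>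

lemma mdeg_UNIV: "mdeg (m :: 'n::finite \<Rightarrow>\<^sub>0 nat) = (\<Sum>i\<in>UNIV. Poly_Mapping.lookup m i)"
  unfolding mdeg_def by (rule sum.mono_neutral_left) (auto simp: in_keys_iff)

lemma mon_eval_UNIV:
  "mon_eval (m :: 'n::finite \<Rightarrow>\<^sub>0 nat) x = (\<Prod>i\<in>UNIV. x i ^ Poly_Mapping.lookup m i)"
  unfolding mon_eval_def by (rule prod.mono_neutral_left) (auto simp: in_keys_iff)

lemma mdeg_add: "mdeg (m + m' :: 'n::finite \<Rightarrow>\<^sub>0 nat) = mdeg m + mdeg m'"
  by (simp add: mdeg_UNIV lookup_add sum.distrib)

lemma mon_eval_add:
  "mon_eval (m + m' :: 'n::finite \<Rightarrow>\<^sub>0 nat) x = mon_eval m x * mon_eval m' x"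
  by (simp add: mon_eval_UNIV lookup_add power_add prod.distrib)

lemma mdeg_0 [simp]: "mdeg 0 = 0"
  and mdeg_single [simp]: "mdeg (Poly_Mapping.single i k) = k"
  by (simp_all add: mdeg_def)

lemma tdeg_le_iff: "tdeg p \<le> t \<longleftrightarrow> (\<forall>m\<in>Poly_Mapping.keys p. mdeg m \<le> t)"
  by (auto simp: tdeg_def mdeg_def)

lemma mdeg_le_tdeg: "m \<in> Poly_Mapping.keys p \<Longrightarrow> mdeg m \<le> tdeg p"
  using tdeg_le_iff by blast

lemma tdeg_add_le: "tdeg p \<le> t \<Longrightarrow> tdeg q \<le> t \<Longrightarrow> tdeg (p + q) \<le> t"
  unfolding tdeg_le_iff using keys_add[of p q] by blast

lemma tdeg_uminus [simp]: "tdeg (- p) = tdeg p"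
proof -
  have "Poly_Mapping.keys (- p) = Poly_Mapping.keys p" by (auto simp: in_keys_iff)
  then show ?thesis by (simp add: tdeg_def)
qed

lemma tdeg_diff_le: "tdeg p \<le> t \<Longrightarrow> tdeg q \<le> t \<Longrightarrow> tdeg (p - q) \<le> t"
  using tdeg_add_le[of p t "- q"] by simp

lemma tdeg_0 [simp]: "tdeg 0 = 0"
  by (simp add: tdeg_def)

lemma tdeg_sum_le: "(\<And>x. x \<in> A \<Longrightarrow> tdeg (f x) \<le> t) \<Longrightarrow> tdeg (sum f A) \<le> t"
  by (induction A rule: infinite_finite_induct) (auto intro: tdeg_add_le)

lemma tdeg_single_le: "tdeg (Poly_Mapping.single m c) \<le> mdeg m"
  by (auto simp: tdeg_le_iff)

lemma tdeg_mult_le: "tdeg (p * q) \<le> tdeg p + tdeg (q :: 'n::finite mpoly)"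
proof -
  have "mdeg m \<le> tdeg p + tdeg q" if m: "m \<in> Poly_Mapping.keys (p * q)" for m
  proof -
    obtain a b where "m = a + b" "a \<in> Poly_Mapping.keys p" "b \<in> Poly_Mapping.keys q"
      using keys_mult[of p q] m by blast
    then show ?thesis by (auto simp: mdeg_add intro: add_mono mdeg_le_tdeg)
  qed
  then show ?thesis by (auto simp: tdeg_le_iff)
qed

lemma tdeg_mult_le': "tdeg p \<le> a \<Longrightarrow> tdeg q \<le> b \<Longrightarrow> a + b \<le> c \<Longrightarrow> tdeg (p * q) \<le> c"
  for p q :: "'n::finite mpoly"
  using tdeg_mult_le[of p q] by linarith

lemma tdeg_mconst [simp]: "tdeg (mconst c) = 0"
  using tdeg_single_le[of 0 c] by (simp add: mconst_def)

lemma tdeg_1 [simp]: "tdeg 1 = 0"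
  using tdeg_mconst[of 1] by (simp add: mconst_def)

lemma tdeg_mconst_mult_le: "tdeg p \<le> t \<Longrightarrow> tdeg (mconst c * p) \<le> t"
  for p :: "'n::finite mpoly"
  by (rule tdeg_mult_le') auto

lemma tdeg_power_le: "tdeg p \<le> t \<Longrightarrow> tdeg (p ^ k) \<le> k * t" for p :: "'n::finite mpoly"
  by (induction k) (auto intro: tdeg_mult_le')

lemma mconst_0 [simp]: "mconst 0 = 0"
  and mconst_1 [simp]: "mconst 1 = 1"
  and mconst_add: "mconst (a + b) = mconst a + mconst b"
  and mconst_uminus: "mconst (- a) = - mconst a"
  and mconst_diff: "mconst (a - b) = mconst a - mconst b"
  and mconst_mult: "mconst (a * b) = mconst a * mconst b"
  by (simp_all add: mconst_def single_add single_uminus single_diff mult_single)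

lemma mconst_power: "mconst (a ^ k) = mconst a ^ k"
  by (induction k) (simp_all add: mconst_mult)

lemma mconst_mult_single: "mconst a * Poly_Mapping.single m b = Poly_Mapping.single m (a * b)"
  by (simp add: mconst_def mult_single)

lemma mpoly_eq_sum_mon:
  "p = (\<Sum>m\<in>Poly_Mapping.keys p. mconst (Poly_Mapping.lookup p m) * mon m)"
proof (rule poly_mapping_eqI)
  fix k
  show "Poly_Mapping.lookup p k = Poly_Mapping.lookup
    (\<Sum>m\<in>Poly_Mapping.keys p. mconst (Poly_Mapping.lookup p m) * mon m) k"
    by (simp add: lookup_sum mconst_mult_single lookup_single when_def in_keys_iff)
qed

lemma meval_superset:
  assumes "finite A" "Poly_Mapping.keys p \<subseteq> A"
  shows "meval p x = (\<Sum>m\<in>A. Poly_Mapping.lookup p m * mon_eval m x)"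
  unfolding meval_def mon_eval_def
  by (rule sum.mono_neutral_left) (use assms in \<open>auto simp: in_keys_iff\<close>)

lemma meval_add [simp]: "meval (p + q) x = meval p x + meval q x"
proof -
  let ?A = "Poly_Mapping.keys p \<union> Poly_Mapping.keys q"
  have "meval r x = (\<Sum>m\<in>?A. Poly_Mapping.lookup r m * mon_eval m x)"
    if "r \<in> {p, q, p + q}" for r
    by (rule meval_superset) (use that keys_add[of p q] in auto)
  then show ?thesis by (simp add: lookup_add sum.distrib algebra_simps)
qed

lemma meval_0 [simp]: "meval 0 x = 0"
  by (simp add: meval_def)

lemma meval_uminus [simp]: "meval (- p) x = - meval p x"
  using meval_add[of p "- p" x] by (simp del: meval_add)

lemma meval_diff [simp]: "meval (p - q) x = meval p x - meval q x"
  using meval_add[of p "- q" x] by (simp del: meval_add)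

lemma meval_sum [simp]: "meval (sum f A) x = (\<Sum>a\<in>A. meval (f a) x)"
  by (induction A rule: infinite_finite_induct) simp_all

lemma meval_single [simp]: "meval (Poly_Mapping.single m c) x = c * mon_eval m x"
  by (subst meval_superset[of "{m}"]) (auto split: if_splits)

lemma meval_mult [simp]: "meval (p * q) x = meval p x * meval q x" for p q :: "'n::finite mpoly"
proof -
  let ?s = "\<lambda>p m. Poly_Mapping.single m (Poly_Mapping.lookup p m)"
  have *: "r = (\<Sum>m\<in>Poly_Mapping.keys r. ?s r m)" for r :: "'n mpoly"
    using mpoly_eq_sum_mon[of r] by (simp add: mconst_mult_single)
  have "p * q = (\<Sum>a\<in>Poly_Mapping.keys p. \<Sum>b\<in>Poly_Mapping.keys q. ?s p a * ?s q b)"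
    by (subst *[of p], subst *[of q]) (simp only: sum_product)
  then have "meval (p * q) x =
      (\<Sum>a\<in>Poly_Mapping.keys p. \<Sum>b\<in>Poly_Mapping.keys q. meval (?s p a) x * meval (?s q b) x)"
    by (simp add: mult_single mon_eval_add mult_ac)
  also have "\<dots> = meval (\<Sum>m\<in>Poly_Mapping.keys p. ?s p m) x * meval (\<Sum>m\<in>Poly_Mapping.keys q. ?s q m) x"
    by (simp only: sum_product meval_sum)
  finally show ?thesis using *[of p] *[of q] by simp
qed

lemma meval_mconst [simp]: "meval (mconst c) x = c"
  by (simp add: mconst_def mon_eval_def)

lemma meval_1 [simp]: "meval 1 x = 1"
  using meval_mconst[of 1 x] by simp

lemma meval_mvar [simp]: "meval (mvar i) x = x i"
  by (simp add: mvar_def mon_eval_def)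

lemma meval_prod [simp]: "meval (prod f A) x = (\<Prod>a\<in>A. meval (f a) x)"
  for f :: "'a \<Rightarrow> 'n::finite mpoly"
  by (induction A rule: infinite_finite_induct) simp_all

lemma mon_single_eq_power: "mon (Poly_Mapping.single i k) = mvar i ^ k"
proof (induction k)
  case (Suc k)
  have "mon (Poly_Mapping.single i (Suc k)) = mvar i * mon (Poly_Mapping.single i k)"
    by (simp add: mvar_def mult_single flip: single_add)
  then show ?case using Suc by simp
qed simp

lemma mon_add: "mon (m + m') = mon m * mon m'"
  by (simp add: mult_single)

lemma finite_mdeg_le: "finite {m :: 'n::finite \<Rightarrow>\<^sub>0 nat. mdeg m \<le> t}"
proof (rule finite_imageD)
  have "Poly_Mapping.lookup ` {m :: 'n \<Rightarrow>\<^sub>0 nat. mdeg m \<le> t} \<subseteq> PiE UNIV (\<lambda>_. {..t})"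
  proof
    fix f assume "f \<in> Poly_Mapping.lookup ` {m :: 'n \<Rightarrow>\<^sub>0 nat. mdeg m \<le> t}"
    then obtain m where m: "f = Poly_Mapping.lookup m" "mdeg m \<le> t" by blast
    have "Poly_Mapping.lookup m i \<le> mdeg m" for i
      unfolding mdeg_UNIV by (rule member_le_sum) auto
    then show "f \<in> PiE UNIV (\<lambda>_. {..t})" using m le_trans by (auto intro: le_trans)
  qed
  then show "finite (Poly_Mapping.lookup ` {m :: 'n \<Rightarrow>\<^sub>0 nat. mdeg m \<le> t})"
    by (rule finite_subset) (auto intro: finite_PiE)
  show "inj_on Poly_Mapping.lookup {m :: 'n \<Rightarrow>\<^sub>0 nat. mdeg m \<le> t}"
    by (auto intro: inj_onI poly_mapping_eqI)
qed

lemma mpoly_ring_induct [case_names const var add mult]: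
  fixes p :: "'n::finite mpoly"
  assumes "\<And>c. P (mconst c)" "\<And>i. P (mvar i)"
    and add: "\<And>p q. P p \<Longrightarrow> P q \<Longrightarrow> P (p + q)" and mult: "\<And>p q. P p \<Longrightarrow> P q \<Longrightarrow> P (p * q)"
  shows "P p"
proof -
  have P0: "P 0" and P1: "P 1" using assms(1)[of 0] assms(1)[of 1] by auto
  have "P (mon m)" for m :: "'n \<Rightarrow>\<^sub>0 nat"
  proof (induction m rule: update_induct)
    case const
    show ?case using P1 by simp
  next
    case (update m i k)
    have "Poly_Mapping.update i k m = m + Poly_Mapping.single i k"
      by (rule poly_mapping_eqI)
        (use update(1) in \<open>auto simp: lookup_update lookup_add lookup_single in_keys_iff\<close>)
    moreover have "P (mvar i ^ k)"
      by (induction k) (use P1 assms(2) mult in auto)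
    ultimately show ?case using update mult by (simp add: mon_add mon_single_eq_power)
  qed
  then have "P (\<Sum>m\<in>A. mconst (Poly_Mapping.lookup p m) * mon m)" for A
    by (induction A rule: infinite_finite_induct) (use P0 assms in auto)
  then show ?thesis using mpoly_eq_sum_mon[of p] by metis
qed

subsection \<open>Quadratic modules\<close>

lemma sos_0: "sos 0"
  unfolding sos_def by (rule exI[of _ "[]"]) simp

lemma sos_square: "sos (a * a)"
  unfolding sos_def by (rule exI[of _ "[a]"]) simp

lemma sos_add:
  assumes "sos p" "sos q"
  shows "sos (p + q)"
proof -
  obtain ps qs where "p = sum_list (map (\<lambda>q. q * q) ps)" "q = sum_list (map (\<lambda>q. q * q) qs)"
    using assms unfolding sos_def by blast
  then have "p + q = sum_list (map (\<lambda>q. q * q) (ps @ qs))" by simp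
  then show ?thesis unfolding sos_def by blast
qed

lemma sos_mult_square: "sos p \<Longrightarrow> sos (a * a * p)"
proof -
  assume "sos p"
  then obtain qs where "p = sum_list (map (\<lambda>q. q * q) qs)" unfolding sos_def by blast
  moreover have "a * a * sum_list (map (\<lambda>q. q * q) qs) =
      sum_list (map (\<lambda>q. q * q) (map ((*) a) qs))" for qs
    by (induction qs) (simp_all add: algebra_simps)
  ultimately show ?thesis unfolding sos_def by blast
qed

lemma meval_sos: "sos p \<Longrightarrow> 0 \<le> meval p x" for p :: "'n::finite mpoly"
proof -
  assume "sos p"
  then obtain qs where "p = sum_list (map (\<lambda>q. q * q) qs)" unfolding sos_def by blast
  moreover have "0 \<le> meval (sum_list (map (\<lambda>q. q * q) qs)) x" by (induction qs) auto
  ultimately show ?thesis by simp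
qed

lemma qmod_t_mono: "t \<le> t' \<Longrightarrow> qmod_t g t \<subseteq> qmod_t g t'"
proof
  fix p assume t: "t \<le> t'" and "p \<in> qmod_t g t"
  then obtain s0 s where s: "s0 \<in> sos_t t"
      "\<forall>j<length g. sos (s j) \<and> (s j = 0 \<or> tdeg (s j) + tdeg (g ! j) \<le> t)"
      "p = s0 + (\<Sum>j<length g. s j * g ! j)"
    unfolding qmod_t_def by blast
  have "s0 \<in> sos_t t'" using s(1) t by (simp add: sos_t_def)
  moreover have "\<forall>j<length g. sos (s j) \<and> (s j = 0 \<or> tdeg (s j) + tdeg (g ! j) \<le> t')"
    using s(2) t le_trans by blast
  ultimately show "p \<in> qmod_t g t'"
    unfolding qmod_t_def using s(3) by blast
qed

lemma qmod_t_add: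
  assumes "p \<in> qmod_t g t" "q \<in> qmod_t g t"
  shows "p + q \<in> qmod_t g t"
proof -
  obtain s0 s where s: "s0 \<in> sos_t t"
      "\<forall>j<length g. sos (s j) \<and> (s j = 0 \<or> tdeg (s j) + tdeg (g ! j) \<le> t)"
      "p = s0 + (\<Sum>j<length g. s j * g ! j)"
    using assms(1) unfolding qmod_t_def by blast
  obtain r0 r where r: "r0 \<in> sos_t t"
      "\<forall>j<length g. sos (r j) \<and> (r j = 0 \<or> tdeg (r j) + tdeg (g ! j) \<le> t)"
      "q = r0 + (\<Sum>j<length g. r j * g ! j)"
    using assms(2) unfolding qmod_t_def by blast
  have "s0 + r0 \<in> sos_t t"
    using s(1) r(1) by (auto simp: sos_t_def intro: sos_add tdeg_add_le)
  moreover have "sos (s j + r j) \<and> (s j + r j = 0 \<or> tdeg (s j + r j) + tdeg (g ! j) \<le> t)"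
    if j: "j < length g" for j
  \<comment> \<open>A zero multiplier carries no degree bound, since \<open>g ! j\<close> alone may
    exceed level \<open>t\<close>; this case has to be split off.\<close>
  proof (cases "s j = 0 \<or> r j = 0")
    case True
    then show ?thesis using s(2) r(2) j by auto
  next
    case False
    then have *: "tdeg (s j) + tdeg (g ! j) \<le> t" "tdeg (r j) + tdeg (g ! j) \<le> t"
      using s(2) r(2) j by auto
    then have "tdeg (s j + r j) \<le> t - tdeg (g ! j)" by (intro tdeg_add_le) auto
    then show ?thesis using * s(2) r(2) j by (auto intro: sos_add)
  qed
  moreover have "p + q = (s0 + r0) + (\<Sum>j<length g. (s j + r j) * g ! j)"
    by (simp add: s(3) r(3) sum.distrib algebra_simps)
  ultimately show ?thesis
    unfolding qmod_t_def mem_Collect_eq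
    by (intro exI[of _ "s0 + r0"] exI[of _ "\<lambda>j. s j + r j"]) blast
qed

lemma square_in_qmod_t: "tdeg (a * a) \<le> t \<Longrightarrow> a * a \<in> qmod_t g t"
  unfolding qmod_t_def mem_Collect_eq
  by (intro exI[of _ "a * a"] exI[of _ "\<lambda>_. 0"]) (auto simp: sos_t_def sos_0 sos_square)

text \<open>A square times a sum of squares is a sum of squares, so a representation can be
  multiplied through term by term. The level grows only by the bound \<open>e\<close> on the
  square.\<close>

lemma qmod_t_mult_square:
  fixes g :: "'n::finite mpoly list"
  assumes "p \<in> qmod_t g t" "tdeg (a * a) \<le> e"
  shows "a * a * p \<in> qmod_t g (t + e)"
proof -
  obtain s0 s where s: "s0 \<in> sos_t t"
      "\<And>j. j < length g \<Longrightarrow> sos (s j) \<and> (s j = 0 \<or> tdeg (s j) + tdeg (g ! j) \<le> t)"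
      "p = s0 + (\<Sum>j<length g. s j * g ! j)"
    using assms(1) unfolding qmod_t_def by blast
  have "a * a * s0 \<in> sos_t (t + e)"
    using s(1) assms(2) unfolding sos_t_def
    by (auto intro: sos_mult_square tdeg_mult_le'[where a = e and b = t])
  moreover have "sos (a * a * s j) \<and> (a * a * s j = 0 \<or> tdeg (a * a * s j) + tdeg (g ! j) \<le> t + e)"
    if j: "j < length g" for j
    using s(2)[OF j] assms(2) tdeg_mult_le[of "a * a" "s j"] by (auto intro: sos_mult_square)
  moreover have "a * a * p = a * a * s0 + (\<Sum>j<length g. (a * a * s j) * g ! j)"
    by (simp add: s(3) distrib_left sum_distrib_left mult.assoc)
  ultimately show ?thesis
    unfolding qmod_t_def mem_Collect_eq
    by (intro exI[of _ "a * a * s0"] exI[of _ "\<lambda>j. a * a * s j"]) blast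
qed

lemma nth_in_qmod_t:
  fixes g :: "'n mpoly list"
  assumes "j < length g"
  shows "g ! j \<in> qmod_t g (tdeg (g ! j))"
  unfolding qmod_t_def mem_Collect_eq
proof (intro exI[of _ 0] exI[of _ "\<lambda>i. if i = j then 1 else 0"] conjI allI impI)
  show "0 \<in> sos_t (tdeg (g ! j))" by (simp add: sos_t_def sos_0)
next
  fix i
  show "sos (if i = j then 1 else 0 :: 'n mpoly)"
    using sos_square[of "1 :: 'n mpoly"] by (simp add: sos_0)
  show "(if i = j then 1 else 0 :: 'n mpoly) = 0 \<or>
      tdeg (if i = j then 1 else 0 :: 'n mpoly) + tdeg (g ! i) \<le> tdeg (g ! j)"
    by simp
next
  have "(\<Sum>i<length g. (if i = j then 1 else 0) * g ! i) = (\<Sum>i<length g. if i = j then g ! i else 0)"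
    by (rule sum.cong) auto
  then show "g ! j = 0 + (\<Sum>i<length g. (if i = j then 1 else 0) * g ! i)"
    using assms by simp
qed

lemma qmodI: "p \<in> qmod_t g t \<Longrightarrow> p \<in> qmod g"
  unfolding qmod_def by blast

lemma qmod_add:
  assumes "p \<in> qmod g" "q \<in> qmod g"
  shows "p + q \<in> qmod g"
proof -
  obtain s t where "p \<in> qmod_t g s" "q \<in> qmod_t g t"
    using assms unfolding qmod_def by blast
  then have "p + q \<in> qmod_t g (max s t)"
    using qmod_t_mono[of s "max s t" g] qmod_t_mono[of t "max s t" g] qmod_t_add by fastforce
  then show ?thesis by (rule qmodI)
qed

lemma square_in_qmod: "a * a \<in> qmod g"
  using square_in_qmod_t qmodI by blast

lemma qmod_mult_square: "p \<in> qmod g \<Longrightarrow> a * a * p \<in> qmod g" for g :: "'n::finite mpoly list"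
  unfolding qmod_def using qmod_t_mult_square by blast

lemma zero_in_qmod: "0 \<in> qmod g"
  using square_in_qmod[of 0 g] by simp

lemma qmod_sum: "(\<And>x. x \<in> A \<Longrightarrow> f x \<in> qmod g) \<Longrightarrow> sum f A \<in> qmod g"
  by (induction A rule: infinite_finite_induct) (auto intro: qmod_add zero_in_qmod)

lemma qmod_mconst_mult:
  fixes g :: "'n::finite mpoly list"
  assumes "p \<in> qmod g" "0 \<le> c"
  shows "mconst c * p \<in> qmod g"
  using qmod_mult_square[OF assms(1), of "mconst (sqrt c)"] assms(2)
  by (simp flip: mconst_mult)

lemma qmod_nonneg:
  fixes g :: "'n::finite mpoly list"
  assumes "p \<in> qmod g" "x \<in> semialg g"
  shows "0 \<le> meval p x"
proof -
  obtain s0 s where s: "sos s0" "\<forall>j<length g. sos (s j)"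
      "p = s0 + (\<Sum>j<length g. s j * g ! j)"
    using assms(1) unfolding qmod_def qmod_t_def sos_t_def by blast
  have "0 \<le> meval s0 x" "\<And>j. j < length g \<Longrightarrow> 0 \<le> meval (s j) x"
    using s(1,2) by (auto intro: meval_sos)
  then show ?thesis
    using s(3) assms(2)
    by (auto simp: semialg_def intro!: add_nonneg_nonneg sum_nonneg mult_nonneg_nonneg)
qed

lemma supp_vanishes:
  fixes g :: "'n::finite mpoly list"
  assumes "p \<in> supp_qm (qmod g)" "x \<in> semialg g"
  shows "meval p x = 0"
  using assms qmod_nonneg[of p g x] qmod_nonneg[of "- p" g x] by (auto simp: supp_qm_def)

text \<open>Writing \<open>r\<close> as the difference of the squares of \<open>(r + 1)/2\<close> and \<open>(r - 1)/2\<close> turns stability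
  of a quadratic module under squares into stability of its support under all multiplications.\<close>
lemma is_ideal_supp_qmod:
  fixes g :: "'n::finite mpoly list"
  shows "is_ideal (supp_qm (qmod g))"
  unfolding is_ideal_def
proof (intro conjI ballI allI)
  show "0 \<in> supp_qm (qmod g)" by (simp add: supp_qm_def zero_in_qmod)
next
  fix a b assume "a \<in> supp_qm (qmod g)" "b \<in> supp_qm (qmod g)"
  then show "a + b \<in> supp_qm (qmod g)"
    using qmod_add[of a g b] qmod_add[of "- a" g "- b"] by (simp add: supp_qm_def)
next
  fix a r assume a: "a \<in> supp_qm (qmod g)"
  define h b c where "h = (mconst (1/2) :: 'n mpoly)" and "b = h * (r + 1)" and "c = h * (r - 1)"
  have "h + h = 1" by (simp add: h_def flip: mconst_add)
  moreover have "b + c = (h + h) * r" "b - c = h + h"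
    by (simp_all add: b_def c_def algebra_simps)
  ultimately have "b + c = r" "b - c = 1" by simp_all
  then have "r = (b + c) * (b - c)" by simp
  then have r: "r = b * b - c * c" by (simp add: algebra_simps)
  show "r * a \<in> supp_qm (qmod g)"
    using a qmod_add[OF qmod_mult_square[of a g b] qmod_mult_square[of "- a" g c]]
      qmod_add[OF qmod_mult_square[of "- a" g b] qmod_mult_square[of a g c]]
    by (simp add: supp_qm_def r algebra_simps)
qed

text \<open>A quadratic module need not be closed under products, but a power of one element is a
  square or a square times that element.\<close>

lemma qmod_power:
  fixes g :: "'n::finite mpoly list"
  assumes "v \<in> qmod g"
  shows "v ^ k \<in> qmod g"
proof (cases "even k")
  case True
  then obtain l where "k = l + l" by (metis evenE mult_2)
  then show ?thesis using square_in_qmod[of "v ^ l" g] by (simp add: power_add)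
next
  case False
  then obtain l where "k = Suc (l + l)" by (metis oddE mult_2 Suc_eq_plus1)
  then show ?thesis
    using qmod_mult_square[OF assms, of "v ^ l"] by (simp add: power_add mult_ac)
qed

text \<open>In the binomial expansion every term except the one for \<open>k = 0\<close> is a
  nonnegative constant times a power of \<open>v\<close>.\<close>

lemma qmod_power_mconst_add:
  fixes g :: "'n::finite mpoly list"
  assumes "v \<in> qmod g" "0 < c"
  obtains q where "q \<in> qmod g" "(mconst c + v) ^ N = mconst (c ^ N) + q"
proof
  let ?f = "\<lambda>k. of_nat (N choose k) * v ^ k * mconst c ^ (N - k)"
  have "?f k \<in> qmod g" for k
  proof -
    have "mconst (of_nat (N choose k) * c ^ (N - k)) * v ^ k \<in> qmod g"
      using assms by (intro qmod_mconst_mult qmod_power) auto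
    moreover have "(mconst (of_nat l) :: 'n mpoly) = of_nat l" for l :: nat
      by (simp add: mconst_def)
    then have "mconst (of_nat (N choose k) * c ^ (N - k)) * v ^ k = ?f k"
      by (simp add: mconst_mult mconst_power mult_ac)
    ultimately show ?thesis by simp
  qed
  then show "(\<Sum>k\<in>{..N} - {0}. ?f k) \<in> qmod g" by (intro qmod_sum)
  have "(mconst c + v) ^ N = (\<Sum>k\<le>N. ?f k)"
    by (subst add.commute) (rule binomial_ring)
  also have "\<dots> = ?f 0 + (\<Sum>k\<in>{..N} - {0}. ?f k)"
    by (rule sum.remove) auto
  finally show "(mconst c + v) ^ N = mconst (c ^ N) + (\<Sum>k\<in>{..N} - {0}. ?f k)"
    by (simp add: mconst_power)
qed

subsection \<open>Ideals\<close>

lemma ideal_0: "is_ideal I \<Longrightarrow> 0 \<in> I"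
  and ideal_add: "is_ideal I \<Longrightarrow> a \<in> I \<Longrightarrow> b \<in> I \<Longrightarrow> a + b \<in> I"
  and ideal_mult_left: "is_ideal I \<Longrightarrow> a \<in> I \<Longrightarrow> r * a \<in> I"
  and ideal_mult_right: "is_ideal I \<Longrightarrow> a \<in> I \<Longrightarrow> a * r \<in> I"
  unfolding is_ideal_def by (simp_all add: mult.commute[of a r])

lemma ideal_diff: "is_ideal I \<Longrightarrow> a \<in> I \<Longrightarrow> b \<in> I \<Longrightarrow> a - b \<in> I"
  using ideal_add[of I a "- 1 * b"] ideal_mult_left[of I b "- 1"] by simp

lemma ideal_sum: "is_ideal I \<Longrightarrow> (\<And>x. x \<in> A \<Longrightarrow> f x \<in> I) \<Longrightarrow> sum f A \<in> I"
  by (induction A rule: infinite_finite_induct) (auto intro: ideal_0 ideal_add)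

lemma ideal_mconst_cancel:
  assumes "is_ideal I" "mconst c * a \<in> I" "c \<noteq> 0"
  shows "a \<in> I"
  using ideal_mult_left[OF assms(1,2), of "mconst (1 / c)"] assms(3)
  by (simp flip: mult.assoc mconst_mult)

lemma prime_idealD: "is_prime_ideal P \<Longrightarrow> is_ideal P"
  and prime_ideal_one: "is_prime_ideal P \<Longrightarrow> 1 \<notin> P"
  and prime_ideal_mult: "is_prime_ideal P \<Longrightarrow> a * b \<in> P \<Longrightarrow> a \<in> P \<or> b \<in> P"
  unfolding is_prime_ideal_def by auto

lemma is_ideal_adjoin:
  assumes I: "is_ideal I"
  shows "is_ideal {p + r * a | p r. p \<in> I}"
  unfolding is_ideal_def
proof (intro conjI ballI allI)
  have "0 = 0 + 0 * a" by simp
  then show "0 \<in> {p + r * a | p r. p \<in> I}" using ideal_0[OF I] by blast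
next
  fix u v assume "u \<in> {p + r * a | p r. p \<in> I}" "v \<in> {p + r * a | p r. p \<in> I}"
  then obtain p r q s where "u = p + r * a" "p \<in> I" "v = q + s * a" "q \<in> I" by blast
  then have "u + v = (p + q) + (r + s) * a" "p + q \<in> I"
    using ideal_add[OF I] by (auto simp: distrib_right)
  then show "u + v \<in> {p + r * a | p r. p \<in> I}" by blast
next
  fix u s assume "u \<in> {p + r * a | p r. p \<in> I}"
  then obtain p r where "u = p + r * a" "p \<in> I" by blast
  then have "s * u = s * p + (s * r) * a" "s * p \<in> I"
    using ideal_mult_left[OF I] by (simp_all add: distrib_left mult.assoc)
  then show "s * u \<in> {p + r * a | p r. p \<in> I}" by blast
qed

lemma subset_ideal_adjoin: "(I :: 'n mpoly set) \<subseteq> {p + r * a | p r. p \<in> I}"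
proof
  fix x assume "x \<in> I"
  moreover have "x = x + 0 * a" by simp
  ultimately show "x \<in> {p + r * a | p r. p \<in> I}" by blast
qed

lemma in_ideal_adjoin:
  assumes "is_ideal I"
  shows "a \<in> {p + r * a | p r. p \<in> I}"
proof -
  have "a = 0 + 1 * a" by simp
  then show ?thesis using ideal_0[OF assms] by blast
qed

text \<open>By Zorn there is an ideal \<open>P\<close> maximal among those containing
  \<open>I\<close> and disjoint from \<open>M\<close>. It is prime: if \<open>a\<close> and
  \<open>b\<close> lie outside \<open>P\<close>, adjoining either one makes \<open>P\<close> meet
  \<open>M\<close>, and with \<open>a * b \<in> P\<close> the product of the two witnesses would lie
  in both \<open>P\<close> and \<open>M\<close>.\<close>

lemma prime_ideal_avoiding:
  fixes I :: "'n mpoly set"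
  assumes I: "is_ideal I" and one: "1 \<in> M" and mult: "\<And>a b. a \<in> M \<Longrightarrow> b \<in> M \<Longrightarrow> a * b \<in> M"
    and disj: "I \<inter> M = {}"
  obtains P where "is_prime_ideal P" "I \<subseteq> P" "P \<inter> M = {}"
proof -
  define A where "A = {K. is_ideal K \<and> I \<subseteq> K \<and> K \<inter> M = {}}"
  have "\<exists>P\<in>A. \<forall>K\<in>A. P \<subseteq> K \<longrightarrow> K = P"
  proof (rule subset_Zorn_nonempty)
    show "A \<noteq> {}" using I disj by (auto simp: A_def)
  next
    fix C assume ne: "C \<noteq> {}" and ch: "subset.chain A C"
    have CA: "C \<subseteq> A" using ch by (simp add: subset.chain_def)
    have "is_ideal (\<Union>C)"
      unfolding is_ideal_def
    proof (intro conjI ballI allI)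
      show "0 \<in> \<Union>C" using ne CA ideal_0 unfolding A_def by blast
    next
      fix a b assume "a \<in> \<Union>C" "b \<in> \<Union>C"
      then obtain K L where KL: "a \<in> K" "K \<in> C" "b \<in> L" "L \<in> C" by blast
      then have "K \<subseteq> L \<or> L \<subseteq> K" using ch by (auto simp: subset_chain_def)
      then show "a + b \<in> \<Union>C"
        using KL CA unfolding A_def by (blast intro: ideal_add)
    next
      fix a r assume "a \<in> \<Union>C"
      then show "r * a \<in> \<Union>C" using CA by (auto simp: A_def intro: ideal_mult_left)
    qed
    then show "\<Union>C \<in> A" using ne CA by (auto simp: A_def)
  qed
  then obtain P where "P \<in> A" and max: "\<And>K. K \<in> A \<Longrightarrow> P \<subseteq> K \<Longrightarrow> K = P" by blast
  then have P: "is_ideal P" "I \<subseteq> P" "P \<inter> M = {}" by (auto simp: A_def)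
  have meets: "\<exists>p r. p \<in> P \<and> p + r * a \<in> M" if "a \<notin> P" for a
  proof (rule ccontr)
    assume none: "\<not> ?thesis"
    let ?K = "{p + r * a | p r. p \<in> P}"
    have sub: "P \<subseteq> ?K" by (rule subset_ideal_adjoin)
    then have "?K \<in> A" using none P is_ideal_adjoin[OF P(1)] by (auto simp: A_def)
    then have "?K = P" using sub by (rule max)
    moreover have "a \<in> ?K" using P(1) by (rule in_ideal_adjoin)
    ultimately show False using that by simp
  qed
  have "a \<in> P \<or> b \<in> P" if ab: "a * b \<in> P" for a b
  proof (rule ccontr)
    assume "\<not> ?thesis"
    then obtain p r q s where *: "p \<in> P" "p + r * a \<in> M" "q \<in> P" "q + s * b \<in> M"
      using meets by blast
    then have "(p + r * a) * (q + s * b) \<in> M" by (intro mult)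
    moreover have "(p + r * a) * (q + s * b) = p * (q + s * b) + (r * a) * q + (r * s) * (a * b)"
      by (simp add: algebra_simps)
    moreover have "p * (q + s * b) \<in> P" "(r * a) * q \<in> P" "(r * s) * (a * b) \<in> P"
      using * ab P(1) by (blast intro: ideal_mult_left ideal_mult_right)+
    ultimately have "(p + r * a) * (q + s * b) \<in> M \<and> (p + r * a) * (q + s * b) \<in> P"
      using ideal_add[OF P(1)] by simp
    then show False using P(3) by blast
  qed
  then have "is_prime_ideal P" using P one unfolding is_prime_ideal_def by blast
  then show thesis using that P by blast
qed

text \<open>Dimension zero includes the existence of a chain of length 0, that is, of a prime above
  \<open>I\<close>.\<close>

lemma krull_dim_zero_one_notin:
  assumes "krull_dim_quot_zero I"
  shows "1 \<notin> I"
proof -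
  have "0 \<in> prime_chain_lengths I" using assms by (simp add: krull_dim_quot_zero_def)
  then show ?thesis by (auto simp: prime_chain_lengths_def is_prime_ideal_def)
qed

text \<open>Were the ideal generated by \<open>P\<close> and \<open>f\<close> proper, a prime above
  it would strictly contain \<open>P\<close> and give a chain of length 1.\<close>

lemma krull_dim_zero_prime_maximal:
  assumes dim: "krull_dim_quot_zero I" and P: "is_prime_ideal P" "I \<subseteq> P" and "f \<notin> P"
  obtains r where "r * f - 1 \<in> P"
proof -
  let ?K = "{p + r * f | p r. p \<in> P}"
  have id: "is_ideal P" using P(1) by (rule prime_idealD)
  have "1 \<in> ?K"
  proof (rule ccontr)
    assume "1 \<notin> ?K"
    then have disj: "?K \<inter> {1} = {}" by simp
    obtain P' where P': "is_prime_ideal P'" "?K \<subseteq> P'"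
      by (rule prime_ideal_avoiding[OF is_ideal_adjoin[OF id] _ _ disj]) auto
    have "P \<subseteq> ?K" by (rule subset_ideal_adjoin)
    moreover have "f \<in> ?K" using id by (rule in_ideal_adjoin)
    ultimately have "P \<subset> P'" using P'(2) \<open>f \<notin> P\<close> by blast
    then have "1 \<in> prime_chain_lengths I"
      unfolding prime_chain_lengths_def mem_Collect_eq
      using P P' by (intro exI[of _ "\<lambda>i. if i = 0 then P else P'"]) auto
    then show False using dim by (simp add: krull_dim_quot_zero_def)
  qed
  then obtain p r where pr: "1 = p + r * f" "p \<in> P" by blast
  have "r * f - 1 = r * f - (p + r * f)" using pr(1) by simp
  also have "\<dots> = 0 - p" by simp
  finally have "r * f - 1 \<in> P" using ideal_diff[OF id ideal_0[OF id] pr(2)] by simp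
  then show thesis by (rule that)
qed

subsection \<open>Univariate polynomials in an element\<close>

text \<open>Real univariate polynomials are evaluated both at elements of the polynomial ring
  (\<open>mc\<close>) and at complex numbers (\<open>cr\<close>); the locale treats the two
  coefficient embeddings at once.\<close>

locale coeff_hom =
  fixes f :: "'a::comm_ring_1 \<Rightarrow> 'b::comm_ring_1"
  assumes hom_0 [simp]: "f 0 = 0" and hom_1 [simp]: "f 1 = 1"
    and hom_add: "f (a + b) = f a + f b" and hom_mult: "f (a * b) = f a * f b"
begin

definition peval :: "'b \<Rightarrow> 'a poly \<Rightarrow> 'b" where
  "peval x u = poly (map_poly f u) x"

lemma peval_0 [simp]: "peval x 0 = 0"
  by (simp add: peval_def)

lemma peval_pCons [simp]: "peval x (pCons a u) = f a + x * peval x u"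
  by (simp add: peval_def map_poly_pCons)

lemma peval_add: "peval x (u + v) = peval x u + peval x v"
proof -
  have "map_poly f (u + v) = map_poly f u + map_poly f v"
    by (rule poly_eqI) (simp add: coeff_map_poly hom_add)
  then show ?thesis by (simp add: peval_def)
qed

lemma peval_smult: "peval x (smult c u) = f c * peval x u"
  by (induction u) (simp_all add: hom_mult algebra_simps)

lemma peval_mult: "peval x (u * v) = peval x u * peval x v"
  by (induction u) (simp_all add: peval_add peval_smult algebra_simps)

lemma peval_sum: "peval x (sum w A) = (\<Sum>a\<in>A. peval x (w a))"
  by (induction A rule: infinite_finite_induct) (simp_all add: peval_add)

lemma peval_1 [simp]: "peval x 1 = 1"
  by (simp add: one_pCons)

lemma peval_prod: "peval x (prod w A) = (\<Prod>a\<in>A. peval x (w a))"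
  by (induction A rule: infinite_finite_induct) (simp_all add: peval_mult)

end

interpretation mc: coeff_hom mconst
  by unfold_locales (simp_all add: mconst_add mconst_mult)

interpretation cr: coeff_hom complex_of_real
  by unfold_locales simp_all

lemma meval_peval: "meval (mc.peval p u) x = poly u (meval p x)" for p :: "'n::finite mpoly"
  by (induction u) simp_all

lemma real_poly_complex_root:
  fixes u :: "real poly"
  assumes "degree u \<noteq> 0"
  obtains z where "cr.peval z u = 0"
proof -
  let ?u = "map_poly complex_of_real u"
  have "degree ?u = degree u" by (simp add: degree_map_poly)
  then have "\<not> constant (poly ?u)" using assms by (simp add: constant_degree)
  then obtain z where "poly ?u z = 0" using fundamental_theorem_of_algebra by blast
  then show thesis using that by (simp add: cr.peval_def)
qed

lemma real_root_of_cr_peval: "cr.peval (complex_of_real a) u = complex_of_real (poly u a)"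
  by (induction u) simp_all

text \<open>A complex root \<open>a + b * \<i>\<close> of \<open>u\<close> yields a real factor,
  linear if \<open>b = 0\<close> and \<open>(X - a)^2 + b^2\<close> otherwise. By primality this
  factor or the cofactor of smaller degree evaluates into \<open>P\<close>. In the linear case the
  square is taken, so that both cases have one form.\<close>

lemma prime_ideal_contains_quadratic:
  fixes x :: "'n mpoly"
  assumes P: "is_prime_ideal P" and "u \<noteq> 0" "mc.peval x u \<in> P"
  shows "\<exists>a b. (x - mconst a) * (x - mconst a) + mconst (b\<^sup>2) \<in> P"
  using assms(2,3)
proof (induction "degree u" arbitrary: u rule: less_induct)
  case less
  have id: "is_ideal P" using P by (rule prime_idealD)
  let ?quad = "\<exists>a b. (x - mconst a) * (x - mconst a) + mconst (b\<^sup>2) \<in> P"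
  have step: ?quad
    if u: "u = q * v" and q: "degree q \<noteq> 0"
      and Q: "mc.peval x q \<in> P \<Longrightarrow> ?quad" for q v
  proof -
    have "mc.peval x q \<in> P \<or> mc.peval x v \<in> P"
      using less.prems(2) u prime_ideal_mult[OF P] by (simp add: mc.peval_mult)
    moreover have "v \<noteq> 0" "degree v < degree u"
      using u q less.prems(1) by (auto simp: degree_mult_eq)
    ultimately show ?thesis using less.hyps Q by blast
  qed
  show ?case
  proof (cases "degree u = 0")
    case True
    then obtain c where c: "u = [:c:]" by (rule degree_eq_zeroE)
    then have "mconst c * 1 \<in> P" "c \<noteq> 0" using less.prems by auto
    then show ?thesis using ideal_mconst_cancel[OF id] prime_ideal_one[OF P] by blast
  next
    case False
    then obtain z where z: "cr.peval z u = 0" by (rule real_poly_complex_root)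
    define a b where "a = Re z" and "b = Im z"
    show ?thesis
    proof (cases "b = 0")
      case True
      then have "z = complex_of_real a" by (simp add: a_def b_def complex_eq_iff)
      then have "poly u a = 0" using z by (simp add: real_root_of_cr_peval)
      then obtain v where v: "u = [:-a, 1:] * v" unfolding poly_eq_0_iff_dvd by (rule dvdE)
      show ?thesis
      proof (rule step[OF v])
        assume "mc.peval x [:-a, 1:] \<in> P"
        then have "(x - mconst a) * (x - mconst a) + mconst (0\<^sup>2) \<in> P"
          using ideal_mult_left[OF id, of "x - mconst a" "x - mconst a"]
          by (simp add: mconst_uminus)
        then show ?quad by blast
      qed simp
    next
      case False
      define q where "q = [:a\<^sup>2 + b\<^sup>2, - 2 * a, 1:]"
      have "cr.peval z q = 0"
        by (simp add: q_def complex_eq_iff a_def b_def power2_eq_square algebra_simps)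
      moreover have "u = q * (u div q) + u mod q" by simp
      ultimately have "cr.peval z (u mod q) = 0"
        using z by (metis add_0 cr.peval_add cr.peval_mult mult_zero_left)
      moreover obtain r s where rs: "u mod q = [:r, s:]"
      proof -
        obtain r w where w: "u mod q = pCons r w" by (cases "u mod q")
        have "degree (u mod q) < 2"
          using degree_mod_less[of q u] by (auto simp: q_def)
        then have "degree w = 0" using w by (auto simp: degree_pCons_eq_if split: if_splits)
        then show thesis using w that by (auto elim: degree_eq_zeroE)
      qed
      \<comment> \<open>A real polynomial of degree at most 1 that vanishes at a non-real number is
        zero.\<close>
      ultimately have "s = 0" "r = 0" using False by (auto simp: complex_eq_iff b_def)
      then have v: "u = q * (u div q)" using rs by (metis \<open>u = q * (u div q) + u mod q\<close> add.right_neutral pCons_0_0)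
      show ?thesis
      proof (rule step[OF v])
        have "mc.peval x q = (x - mconst a) * (x - mconst a) + mconst (b\<^sup>2)"
        proof -
          have "(mconst 2 :: 'n mpoly) = 2" using mconst_add[of 1 1] by simp
          then show ?thesis
            by (simp add: q_def mconst_add mconst_uminus power2_eq_square mconst_mult algebra_simps)
        qed
        then show "mc.peval x q \<in> P \<Longrightarrow> ?quad" by metis
      qed (simp add: q_def)
    qed
  qed
qed

text \<open>Zariski's lemma over the uncountable field of reals: were \<open>x\<close> transcendental modulo the maximal
  ideal \<open>P\<close>, uncountably many of the inverses of the \<open>x - c\<close> would be represented by polynomials of
  one bounded degree, hence be linearly dependent; clearing denominators in a linear
  relation gives a polynomial equation for \<open>x\<close>.\<close>
lemma algebraic_mod_maximal_ideal:
  fixes P :: "'n::finite mpoly set" and x :: "'n mpoly"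
  assumes P: "is_prime_ideal P" and max: "\<And>f. f \<notin> P \<Longrightarrow> \<exists>r. r * f - 1 \<in> P"
  shows "\<exists>u. u \<noteq> 0 \<and> mc.peval x u \<in> P"
proof (rule ccontr)
  assume "\<not> ?thesis"
  then have none: "mc.peval x u \<notin> P" if "u \<noteq> 0" for u using that by blast
  have id: "is_ideal P" using P by (rule prime_idealD)
  have lin: "mc.peval x [:-c, 1:] = x - mconst c" for c by (simp add: mconst_uminus)
  have "\<exists>r. r * (x - mconst c) - 1 \<in> P" for c
    using none[of "[:-c, 1:]"] unfolding lin by (intro max) simp
  then obtain q where q: "q c * (x - mconst c) - 1 \<in> P" for c by metis
  have "\<exists>t. infinite {c. tdeg (q c) \<le> t}"
  proof (rule ccontr)
    assume "\<not> ?thesis"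
    then have "countable (\<Union>t. {c. tdeg (q c) \<le> t})"
      by (intro countable_UN) (auto intro: countable_finite)
    moreover have "(\<Union>t. {c. tdeg (q c) \<le> t}) = UNIV" by auto
    ultimately show False using uncountable_UNIV_real by simp
  qed
  then obtain t where t: "infinite {c. tdeg (q c) \<le> t}" by blast
  interpret vs: vector_space "\<lambda>c (p :: 'n mpoly). mconst c * p"
    by unfold_locales (simp_all add: mconst_add mconst_mult algebra_simps)
  define B where "B = mon ` {m :: 'n \<Rightarrow>\<^sub>0 nat. mdeg m \<le> t}"
  have B: "finite B" unfolding B_def by (intro finite_imageI finite_mdeg_le)
  \<comment> \<open>One more element than there are monomials of degree at most \<open>t\<close>
    forces a linear dependence.\<close>
  obtain C where C: "finite C" "card C = Suc (card B)" "C \<subseteq> {c. tdeg (q c) \<le> t}"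
    using infinite_arbitrarily_large[OF t] by blast
  have inj: "inj_on q C"
  proof (rule inj_onI, rule ccontr)
    fix c d assume eq: "q c = q d" and "c \<noteq> d"
    have "(q c * (x - mconst c) - 1) - (q c * (x - mconst d) - 1) \<in> P"
      by (rule ideal_diff[OF id q]) (use q[of d] eq in simp)
    then have "mconst (d - c) * q c \<in> P" by (simp add: mconst_diff algebra_simps)
    then have "q c \<in> P" using ideal_mconst_cancel[OF id] \<open>c \<noteq> d\<close> by auto
    then have "q c * (x - mconst c) - (q c * (x - mconst c) - 1) \<in> P"
      by (rule ideal_diff[OF id ideal_mult_right[OF id] q])
    then show False using prime_ideal_one[OF P] by simp
  qed
  have "q ` C \<subseteq> vs.span B"
  proof
    fix p assume "p \<in> q ` C"
    then have "tdeg p \<le> t" using C(3) by blast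
    then have "mon m \<in> vs.span B" if "m \<in> Poly_Mapping.keys p" for m
      using that unfolding B_def tdeg_le_iff by (intro vs.span_base) blast
    then have "(\<Sum>m\<in>Poly_Mapping.keys p. mconst (Poly_Mapping.lookup p m) * mon m) \<in> vs.span B"
      by (intro vs.span_sum vs.span_scale)
    then show "p \<in> vs.span B" using mpoly_eq_sum_mon[of p] by metis
  qed
  then have "vs.dependent (q ` C)"
    using vs.independent_span_bound[OF B] card_image[OF inj] C(2) by fastforce
  then obtain l where "\<exists>p\<in>q ` C. l p \<noteq> 0" "(\<Sum>p\<in>q ` C. mconst (l p) * p) = 0"
    using vs.dependent_finite[of "q ` C"] C(1) by auto
  then obtain c0 where c0: "c0 \<in> C" "l (q c0) \<noteq> 0" and rel: "(\<Sum>c\<in>C. mconst (l (q c)) * q c) = 0"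
    by (auto simp: sum.reindex[OF inj])
  \<comment> \<open>This is the relation between the \<open>1 / (x - c)\<close> multiplied by the
    product of all \<open>x - d\<close>. At \<open>c0\<close> only the term of \<open>c0\<close>
    survives, which shows \<open>u \<noteq> 0\<close>.\<close>
  define u where "u = (\<Sum>c\<in>C. smult (l (q c)) (\<Prod>d\<in>C - {c}. [:-d, 1:]))"
  define W where "W c = (\<Prod>d\<in>C - {c}. x - mconst d)" for c
  have W: "(\<Prod>d\<in>C. x - mconst d) = (x - mconst c) * W c" if "c \<in> C" for c
    unfolding W_def using that C(1) by (rule prod.remove[rotated])
  have "poly u c0 = (\<Sum>c\<in>C. if c = c0 then l (q c0) * (\<Prod>d\<in>C - {c0}. c0 - d) else 0)"
    unfolding u_def poly_sum
  proof (intro sum.cong refl)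
    fix c assume "c \<in> C"
    have "(\<Prod>d\<in>C - {c}. c0 - d) = 0" if "c \<noteq> c0"
      using that c0(1) C(1) by (intro prod_zero) auto
    then show "poly (smult (l (q c)) (\<Prod>d\<in>C - {c}. [:-d, 1:])) c0 =
        (if c = c0 then l (q c0) * (\<Prod>d\<in>C - {c0}. c0 - d) else 0)"
      by (auto simp: poly_prod)
  qed
  also have "\<dots> \<noteq> 0" using c0 C(1) by simp
  finally have "u \<noteq> 0" by auto
  have "mc.peval x u = (\<Sum>c\<in>C. mconst (l (q c)) * W c)"
    unfolding u_def mc.peval_sum mc.peval_smult mc.peval_prod lin W_def ..
  \<comment> \<open>Subtracting a multiple of the vanishing relation makes each summand a multiple
    of \<open>q c * (x - mconst c) - 1\<close>, which lies in \<open>P\<close>.\<close>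
  also have "\<dots> = (\<Sum>c\<in>C. mconst (l (q c)) * W c) -
      (\<Sum>c\<in>C. mconst (l (q c)) * q c) * (\<Prod>d\<in>C. x - mconst d)"
    by (simp add: rel)
  also have "\<dots> = (\<Sum>c\<in>C. - (mconst (l (q c)) * W c) * (q c * (x - mconst c) - 1))"
    unfolding sum_distrib_right sum_subtractf[symmetric]
    by (intro sum.cong refl) (simp add: W algebra_simps)
  also have "\<dots> \<in> P" by (intro ideal_sum[OF id] ideal_mult_left[OF id] q)
  finally show False using none \<open>u \<noteq> 0\<close> by blast
qed

subsection \<open>The support of a zero-dimensional quadratic module\<close>

text \<open>Doubling the exponent makes \<open>f ^ (m + m)\<close> a square. With
  \<open>(c + v)^(2m) = C + q\<close>, the element \<open>- C * f^(2m)\<close> is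
  \<open>- f^(2m) * (C + q)\<close> plus \<open>f^(2m) * q\<close>, both in the module;
  \<open>C * f^(2m)\<close> is there too, and the constant \<open>C\<close> is invertible.\<close>

lemma supp_cancel_positive:
  fixes g :: "'n::finite mpoly list"
  assumes v: "v \<in> qmod g" and c: "0 < c" and f: "(f * (mconst c + v)) ^ m \<in> supp_qm (qmod g)"
  shows "f ^ (m + m) \<in> supp_qm (qmod g)"
proof -
  let ?I = "supp_qm (qmod g)"
  note id = is_ideal_supp_qmod[of g]
  obtain q where q: "q \<in> qmod g" "(mconst c + v) ^ (m + m) = mconst (c ^ (m + m)) + q"
    using qmod_power_mconst_add[OF v c] by blast
  let ?C = "mconst (c ^ (m + m)) :: 'n mpoly"
  have "(f * (mconst c + v)) ^ (m + m) \<in> ?I"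
    unfolding power_add by (rule ideal_mult_left[OF id f])
  then have I: "f ^ m * f ^ m * (?C + q) \<in> ?I"
    unfolding power_mult_distrib q(2) by (simp add: power_add)
  then have "- (f ^ m * f ^ m * (?C + q)) + f ^ m * f ^ m * q \<in> qmod g"
    by (intro qmod_add qmod_mult_square q) (simp add: supp_qm_def)
  moreover have "- (f ^ m * f ^ m * (?C + q)) + f ^ m * f ^ m * q = - (?C * (f ^ m * f ^ m))"
    by (simp add: algebra_simps)
  moreover have "?C * (f ^ m * f ^ m) \<in> qmod g"
    using c by (intro qmod_mconst_mult square_in_qmod) simp
  ultimately have "?C * f ^ (m + m) \<in> ?I" by (simp add: supp_qm_def power_add)
  then show ?thesis using c by (auto dest: ideal_mconst_cancel[OF id])
qed

text \<open>The multiplicative set \<open>M\<close> is built such that a prime ideal containing the support and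
  avoiding \<open>M\<close> has residue field \<open>\<real>\<close> and a rational point at which all \<open>g\<^sub>j\<close> are nonnegative and
  \<open>h\<close> does not vanish.\<close>
lemma vanishing_power_in_supp:
  fixes g :: "'n::finite mpoly list"
  assumes dim: "krull_dim_quot_zero (supp_qm (qmod g))"
    and h: "\<And>x. x \<in> semialg g \<Longrightarrow> meval h x = 0"
  obtains m where "h ^ m \<in> supp_qm (qmod g)"
proof (rule ccontr)
  let ?I = "supp_qm (qmod g)"
  note id = is_ideal_supp_qmod[of g]
  assume "\<not> thesis"
  then have notI: "h ^ m \<notin> ?I" for m using that by blast
  \<comment> \<open>The radical of the support.\<close>
  define R where "R = {f. \<exists>m. f ^ m \<in> ?I}"
  have R_mult: "f * a \<in> R" if f: "f \<in> R" for f a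
  proof -
    obtain m where "f ^ m \<in> ?I" using f by (auto simp: R_def)
    then have "(f * a) ^ m \<in> ?I" using ideal_mult_right[OF id] by (simp add: power_mult_distrib)
    then show ?thesis by (auto simp: R_def)
  qed
  have R_square: "f \<in> R" if "f * f \<in> R" for f
    using that unfolding R_def by (auto simp flip: power2_eq_square power_mult)
  \<comment> \<open>The condition says that the colon ideal \<open>(R : a)\<close> lies in
    \<open>(R : h)\<close>. It holds for \<open>h\<close> itself and for every \<open>c + v\<close>,
    the latter being cancellable modulo \<open>R\<close>; it is stable under products because
    \<open>R\<close> is radical.\<close>
  define M where "M = {a. \<forall>f. f * a \<in> R \<longrightarrow> f * h \<in> R}"
  have M_pos: "mconst c + v \<in> M" if "0 < c" "v \<in> qmod g" for c v
  proof -
    have "f \<in> R" if "f * (mconst c + v) \<in> R" for f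
      using that supp_cancel_positive[OF \<open>v \<in> qmod g\<close> \<open>0 < c\<close>] unfolding R_def by blast
    then show ?thesis unfolding M_def using R_mult by blast
  qed
  have M_h: "h \<in> M" by (simp add: M_def)
  have M_one: "1 \<in> M" using R_mult by (simp add: M_def)
  have M_mult: "a * b \<in> M" if ab: "a \<in> M" "b \<in> M" for a b
    unfolding M_def mem_Collect_eq
  proof (intro allI impI)
    fix f assume "f * (a * b) \<in> R"
    then have "(f * a) * b \<in> R" by (simp add: mult.assoc)
    then have "(f * a) * h \<in> R" using ab(2) by (simp add: M_def)
    then have "(f * h) * a \<in> R" by (simp add: mult_ac)
    then have "(f * h) * h \<in> R" using ab(1) by (simp add: M_def)
    then have "((f * h) * h) * f \<in> R" by (rule R_mult)
    then have "(f * h) * (f * h) \<in> R" by (simp add: mult_ac)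
    then show "f * h \<in> R" by (rule R_square)
  qed
  have disj: "?I \<inter> M = {}"
  proof (rule ccontr)
    \<comment> \<open>An element of the support lying in \<open>M\<close> would, with
      \<open>f = 1\<close>, put \<open>h\<close> into the radical.\<close>
    assume "?I \<inter> M \<noteq> {}"
    then obtain a where a: "a \<in> ?I" "a \<in> M" by blast
    have "a ^ 1 \<in> ?I" using a(1) by simp
    then have "1 * a \<in> R" unfolding R_def mult_1 by blast
    then have "1 * h \<in> R" using a(2) unfolding M_def by blast
    then show False using notI by (auto simp: R_def)
  qed
  obtain P where P: "is_prime_ideal P" "?I \<subseteq> P" "P \<inter> M = {}"
    by (rule prime_ideal_avoiding[OF id M_one M_mult disj]) auto
  have idP: "is_ideal P" using P(1) by (rule prime_idealD)
  have max: "\<exists>r. r * f - 1 \<in> P" if "f \<notin> P" for f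
    using krull_dim_zero_prime_maximal[OF dim P(1,2) that] by blast
  have "\<exists>a. mvar i - mconst a \<in> P" for i
  proof -
    obtain u where "u \<noteq> 0" "mc.peval (mvar i) u \<in> P"
      using algebraic_mod_maximal_ideal[OF P(1) max] by blast
    from prime_ideal_contains_quadratic[OF P(1) this]
    obtain a b where ab: "(mvar i - mconst a) * (mvar i - mconst a) + mconst (b\<^sup>2) \<in> P" by blast
    \<comment> \<open>For \<open>b \<noteq> 0\<close> the quadratic is a positive constant plus a
      square, hence in \<open>M\<close>, although it lies in \<open>P\<close>. So the residue of
      each variable is real.\<close>
    have "b = 0"
    proof (rule ccontr)
      assume "b \<noteq> 0"
      then have "mconst (b\<^sup>2) + (mvar i - mconst a) * (mvar i - mconst a) \<in> M"
        by (intro M_pos square_in_qmod) simp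
      then show False using ab P(3) by (auto simp: add.commute)
    qed
    then show ?thesis using ab prime_ideal_mult[OF P(1)] by auto
  qed
  then obtain \<xi> where \<xi>: "mvar i - mconst (\<xi> i) \<in> P" for i by metis
  have eval: "f - mconst (meval f \<xi>) \<in> P" for f
  proof (induction f rule: mpoly_ring_induct)
    case (const c)
    then show ?case using ideal_0[OF idP] by simp
  next
    case (var i)
    then show ?case using \<xi> by simp
  next
    case (add p q)
    then have "(p - mconst (meval p \<xi>)) + (q - mconst (meval q \<xi>)) \<in> P" by (rule ideal_add[OF idP])
    then show ?case by (simp add: mconst_add algebra_simps)
  next
    case (mult p q)
    then have "(p - mconst (meval p \<xi>)) * q + mconst (meval p \<xi>) * (q - mconst (meval q \<xi>)) \<in> P"
      by (intro ideal_add[OF idP] ideal_mult_right[OF idP] ideal_mult_left[OF idP])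
    then show ?case by (simp add: mconst_mult algebra_simps)
  qed
  \<comment> \<open>If \<open>g ! j\<close> were negative at \<open>\<xi>\<close>, then
    \<open>g ! j\<close> minus its value there would be a positive constant plus a module element,
    so in \<open>M\<close>, while \<open>eval\<close> puts it in \<open>P\<close>.\<close>
  have "\<xi> \<in> semialg g"
    unfolding semialg_def mem_Collect_eq
  proof (intro allI impI, rule ccontr)
    fix j assume j: "j < length g" and "\<not> 0 \<le> meval (g ! j) \<xi>"
    then have "mconst (- meval (g ! j) \<xi>) + g ! j \<in> M"
      by (intro M_pos qmodI[OF nth_in_qmod_t]) auto
    then show False using eval[of "g ! j"] P(3) by (auto simp: mconst_uminus)
  qed
  then have "h \<in> P" using eval[of h] h by simp
  then show False using M_h P(3) by blast
qed

lemma univariate_in_supp: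
  fixes g :: "'n::finite mpoly list"
  assumes dim: "krull_dim_quot_zero (supp_qm (qmod g))"
  shows "\<exists>u. u \<noteq> 0 \<and> mc.peval x u \<in> supp_qm (qmod g)"
proof (rule ccontr)
  let ?I = "supp_qm (qmod g)"
  assume "\<not> ?thesis"
  then have none: "\<forall>u. u \<noteq> 0 \<longrightarrow> mc.peval x u \<notin> ?I" by blast
  let ?M = "mc.peval x ` (- {0})"
  have "?I \<inter> ?M = {}" using none by auto
  moreover have "1 \<in> ?M" by (rule image_eqI[of _ _ 1]) simp_all
  moreover have "a * b \<in> ?M" if ab: "a \<in> ?M" "b \<in> ?M" for a b
  proof -
    obtain u v where "a = mc.peval x u" "b = mc.peval x v" "u \<noteq> 0" "v \<noteq> 0" using ab by auto
    then have "a * b = mc.peval x (u * v)" "u * v \<noteq> 0" by (simp_all add: mc.peval_mult)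
    then show ?thesis by blast
  qed
  ultimately obtain P where P: "is_prime_ideal P" "?I \<subseteq> P" "P \<inter> ?M = {}"
    using prime_ideal_avoiding[OF is_ideal_supp_qmod[of g], of ?M] by metis
  have "\<exists>r. r * f - 1 \<in> P" if "f \<notin> P" for f
    using krull_dim_zero_prime_maximal[OF dim P(1,2) that] by blast
  from algebraic_mod_maximal_ideal[OF P(1) this, of x] show False using P(3) by blast
qed

text \<open>Each coordinate of a point of the set is a root of a fixed nonzero univariate
  polynomial.\<close>

lemma finite_semialg:
  fixes g :: "'n::finite mpoly list"
  assumes dim: "krull_dim_quot_zero (supp_qm (qmod g))"
  shows "finite (semialg g)"
proof -
  obtain u where u: "u i \<noteq> 0" "mc.peval (mvar i) (u i) \<in> supp_qm (qmod g)" for i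
    using univariate_in_supp[OF dim, of "mvar _"] by metis
  have "semialg g \<subseteq> PiE UNIV (\<lambda>i. {r. poly (u i) r = 0})"
    using supp_vanishes[OF u(2)] by (auto simp: meval_peval)
  then show ?thesis
    by (rule finite_subset) (intro finite_PiE finite_UNIV poly_roots_finite u(1))
qed

text \<open>On an empty set even the constant 1 vanishes, which would put 1 into the
  support.\<close>

lemma semialg_nonempty:
  fixes g :: "'n::finite mpoly list"
  assumes dim: "krull_dim_quot_zero (supp_qm (qmod g))"
  shows "semialg g \<noteq> {}"
proof
  assume "semialg g = {}"
  then obtain m where "1 ^ m \<in> supp_qm (qmod g)"
    using vanishing_power_in_supp[OF dim, of 1] by blast
  then show False using krull_dim_zero_one_notin[OF dim] by simp
qed

subsection \<open>Interpolation on a finite set of points\<close>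

text \<open>Lagrange interpolation, with \<open>i\<close> choosing a coordinate that separates two
  points. The crude degree bound suffices to make the \<open>LEAST\<close> in
  \<open>interp_deg\<close> attained.\<close>

lemma interpolation_exists:
  fixes S :: "('n::finite \<Rightarrow> real) set"
  assumes S: "finite S"
  shows "\<exists>t. \<forall>f. \<exists>p. tdeg p \<le> t \<and> (\<forall>\<xi>\<in>S. meval p \<xi> = f \<xi>)"
proof -
  define i where "i \<xi> \<eta> = (SOME i. \<xi> i \<noteq> \<eta> i)" for \<xi> \<eta> :: "'n \<Rightarrow> real"
  have i: "\<xi> (i \<xi> \<eta>) \<noteq> \<eta> (i \<xi> \<eta>)" if "\<xi> \<noteq> \<eta>" for \<xi> \<eta>
    unfolding i_def by (rule someI_ex) (use that in blast)
  define u :: "('n \<Rightarrow> real) \<Rightarrow> 'n mpoly" where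
    "u \<xi> = (\<Prod>\<eta>\<in>S - {\<xi>}. mconst (1 / (\<xi> (i \<xi> \<eta>) - \<eta> (i \<xi> \<eta>))) *
      (mvar (i \<xi> \<eta>) - mconst (\<eta> (i \<xi> \<eta>))))" for \<xi>
  have u: "meval (u \<xi>) \<zeta> = (if \<zeta> = \<xi> then 1 else 0)" if "\<zeta> \<in> S" for \<xi> \<zeta>
  proof (cases "\<zeta> = \<xi>")
    case True
    have "meval (u \<xi>) \<xi> = 1"
      unfolding u_def meval_prod using i by (intro prod.neutral) auto
    then show ?thesis using True by simp
  next
    case False
    then show ?thesis using that S by (auto simp: u_def intro!: prod_zero bexI[of _ \<zeta>])
  qed
  have "\<exists>p. tdeg p \<le> (\<Sum>\<xi>\<in>S. tdeg (u \<xi>)) \<and> (\<forall>\<xi>\<in>S. meval p \<xi> = f \<xi>)" for f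
  proof (intro exI conjI ballI)
    show "tdeg (\<Sum>\<xi>\<in>S. mconst (f \<xi>) * u \<xi>) \<le> (\<Sum>\<xi>\<in>S. tdeg (u \<xi>))"
      using S by (intro tdeg_sum_le tdeg_mconst_mult_le member_le_sum) auto
    show "meval (\<Sum>\<xi>\<in>S. mconst (f \<xi>) * u \<xi>) \<zeta> = f \<zeta>" if "\<zeta> \<in> S" for \<zeta>
      using that S by (simp add: u if_distrib[of "\<lambda>c. _ * c"] cong: if_cong)
  qed
  then show ?thesis by blast
qed

lemma interp_deg_basis:
  fixes S :: "('n::finite \<Rightarrow> real) set"
  assumes "finite S"
  obtains u where "\<And>\<xi>. tdeg (u \<xi>) \<le> interp_deg S"
    "\<And>\<xi> \<zeta>. \<zeta> \<in> S \<Longrightarrow> meval (u \<xi>) \<zeta> = (if \<zeta> = \<xi> then 1 else 0)"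
proof -
  have "\<forall>f. \<exists>p. tdeg p \<le> interp_deg S \<and> (\<forall>\<xi>\<in>S. meval p \<xi> = f \<xi>)"
    unfolding interp_deg_def by (rule LeastI_ex) (rule interpolation_exists[OF assms])
  from this[THEN spec, of "\<lambda>\<zeta>. if \<zeta> = _ then 1 else 0"]
  have "\<forall>\<xi>. \<exists>p. tdeg p \<le> interp_deg S \<and> (\<forall>\<zeta>\<in>S. meval p \<zeta> = (if \<zeta> = \<xi> then 1 else 0))"
    by (rule allI)
  then show thesis using that by metis
qed

subsection \<open>Truncated positive functionals\<close>

lemma Lt_add: "\<sigma> \<in> Lt g t \<Longrightarrow> tdeg p \<le> t \<Longrightarrow> tdeg q \<le> t \<Longrightarrow> \<sigma> (p + q) = \<sigma> p + \<sigma> q"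
  and Lt_mconst_mult: "\<sigma> \<in> Lt g t \<Longrightarrow> tdeg p \<le> t \<Longrightarrow> \<sigma> (mconst c * p) = c * \<sigma> p"
  and Lt_nonneg: "\<sigma> \<in> Lt g t \<Longrightarrow> p \<in> qmod_t g t \<Longrightarrow> 0 \<le> \<sigma> p"
  unfolding Lt_def lin_functional_t_def by blast+

lemma Lt_0: "\<sigma> \<in> Lt g t \<Longrightarrow> \<sigma> 0 = 0"
  using Lt_mconst_mult[of \<sigma> g t 0 0] by simp

lemma Lt_uminus: "\<sigma> \<in> Lt g t \<Longrightarrow> tdeg p \<le> t \<Longrightarrow> \<sigma> (- p) = - \<sigma> p"
  using Lt_mconst_mult[of \<sigma> g t p "- 1"] by (simp add: mconst_uminus)

lemma Lt_diff:
  "\<sigma> \<in> Lt g t \<Longrightarrow> tdeg p \<le> t \<Longrightarrow> tdeg q \<le> t \<Longrightarrow> \<sigma> (p - q) = \<sigma> p - \<sigma> q"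
  using Lt_add[of \<sigma> g t p "- q"] by (simp add: Lt_uminus)

lemma Lt_sum:
  "\<sigma> \<in> Lt g t \<Longrightarrow> (\<And>a. a \<in> A \<Longrightarrow> tdeg (f a) \<le> t) \<Longrightarrow> \<sigma> (sum f A) = (\<Sum>a\<in>A. \<sigma> (f a))"
  by (induction A rule: infinite_finite_induct) (simp_all add: Lt_0 Lt_add tdeg_sum_le)

lemma Lt_eq_0:
  assumes "\<sigma> \<in> Lt g t" "p \<in> qmod_t g t" "- p \<in> qmod_t g t" "tdeg p \<le> t"
  shows "\<sigma> p = 0"
  using Lt_nonneg[OF assms(1,2)] Lt_nonneg[OF assms(1,3)] Lt_uminus[OF assms(1,4)] by simp

text \<open>With \<open>\<sigma> (p * p) = 0\<close> the nonnegative value of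
  \<open>\<sigma>\<close> at the square of \<open>p + l\<close> is a quadratic in \<open>l\<close>
  without constant term, so its linear coefficient \<open>2 * \<sigma> p\<close> must
  vanish.\<close>

lemma Lt_square_eq_0:
  fixes g :: "'n::finite mpoly list"
  assumes \<sigma>: "\<sigma> \<in> Lt g t" and deg: "2 * tdeg p \<le> t" and 0: "\<sigma> (p * p) = 0"
  shows "\<sigma> p = 0"
proof (rule ccontr)
  assume nz: "\<sigma> p \<noteq> 0"
  have dp: "tdeg p \<le> t" and dpp: "tdeg (p * p) \<le> t" and d1: "tdeg (1 :: 'n mpoly) \<le> t"
    using deg tdeg_mult_le[of p p] by auto
  have one: "0 \<le> \<sigma> 1"
    using Lt_nonneg[OF \<sigma> square_in_qmod_t[of 1]] by simp
  have pos: "0 \<le> 2 * l * \<sigma> p + l * l * \<sigma> 1" for l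
  proof -
    let ?q = "p + mconst l"
    have "tdeg (?q * ?q) \<le> t"
      using deg by (intro tdeg_mult_le'[where a = "tdeg p" and b = "tdeg p"] tdeg_add_le) auto
    then have "0 \<le> \<sigma> (?q * ?q)" by (intro Lt_nonneg[OF \<sigma>] square_in_qmod_t)
    also have "(mconst 2 :: 'n mpoly) = 2" using mconst_add[of 1 1] by simp
    then have "?q * ?q = p * p + (mconst (2 * l) * p + mconst (l * l) * 1)"
      by (simp add: mconst_mult algebra_simps)
    also have "\<sigma> \<dots> = 2 * l * \<sigma> p + l * l * \<sigma> 1"
      using 0 dp dpp d1
      by (simp only: Lt_add[OF \<sigma>] Lt_mconst_mult[OF \<sigma>] tdeg_add_le tdeg_mconst_mult_le)
    finally show ?thesis .
  qed
  \<comment> \<open>Adding 1 covers the case \<open>\<sigma> 1 = 0\<close>; the value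
    \<open>l = - s / w\<close> then makes the quadratic negative.\<close>
  define w s where "w = \<sigma> 1 + 1" and "s = \<sigma> p"
  have "w > 0" "w \<ge> \<sigma> 1" using one by (auto simp: w_def)
  have "0 \<le> 2 * (- s / w) * s + (- s / w) * (- s / w) * \<sigma> 1"
    using pos[of "- s / w"] by (simp add: s_def)
  also have "\<dots> \<le> 2 * (- s / w) * s + (- s / w) * (- s / w) * w"
    using \<open>w \<ge> \<sigma> 1\<close> by (intro add_left_mono mult_left_mono) auto
  also have "\<dots> = - (s * s / w)" using \<open>w > 0\<close> by (simp add: field_simps)
  also have "\<dots> < 0" using \<open>w > 0\<close> nz by (simp add: s_def flip: power2_eq_square)
  finally show False by simp
qed

text \<open>The exponent is raised to \<open>2 ^ m\<close>, after which \<open>m\<close> square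
  roots, each taken by \<open>Lt_square_eq_0\<close>, lead down to \<open>h\<close>.\<close>

lemma Lt_eq_0_if_power_in_supp:
  fixes g :: "'n::finite mpoly list"
  assumes "h ^ m \<in> supp_qm (qmod g)"
  shows "\<exists>t0. \<forall>t\<ge>t0. \<forall>\<sigma>\<in>Lt g t. \<sigma> h = 0"
proof -
  have "h ^ (2 ^ m - m) * h ^ m \<in> supp_qm (qmod g)"
    by (rule ideal_mult_left[OF is_ideal_supp_qmod assms])
  then have "h ^ 2 ^ m \<in> supp_qm (qmod g)"
    by (simp add: less_imp_le flip: power_add)
  then obtain t1 t2 where "h ^ 2 ^ m \<in> qmod_t g t1" "- (h ^ 2 ^ m) \<in> qmod_t g t2"
    by (auto simp: supp_qm_def qmod_def)
  then have q: "h ^ 2 ^ m \<in> qmod_t g t" "- (h ^ 2 ^ m) \<in> qmod_t g t" if "t1 + t2 \<le> t" for t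
    using that qmod_t_mono[of t1 t g] qmod_t_mono[of t2 t g] by auto
  \<comment> \<open>The last summand keeps every intermediate square within level
    \<open>t\<close>.\<close>
  have "\<sigma> h = 0" if t: "t1 + t2 + 2 ^ m * tdeg h \<le> t" and \<sigma>: "\<sigma> \<in> Lt g t" for t \<sigma>
  proof -
    have deg: "tdeg (h ^ 2 ^ j) \<le> 2 ^ j * tdeg h" for j by (rule tdeg_power_le) simp
    have "\<sigma> (h ^ 2 ^ (m - j)) = 0" if "j \<le> m" for j
      using that
    proof (induction j)
      case 0
      have "\<sigma> (h ^ 2 ^ m) = 0"
        by (rule Lt_eq_0[OF \<sigma>]) (use q[of t] t deg[of m] in auto)
      then show ?case by simp
    next
      case (Suc j)
      let ?k = "m - Suc j"
      have "m - j = Suc ?k" using Suc.prems by simp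
      then have "\<sigma> (h ^ 2 ^ ?k * h ^ 2 ^ ?k) = 0"
        using Suc by (simp add: mult_2 flip: power_add)
      moreover have "2 * tdeg (h ^ 2 ^ ?k) \<le> t"
      proof -
        have "2 * tdeg (h ^ 2 ^ ?k) \<le> 2 ^ Suc ?k * tdeg h" using deg[of ?k] by simp
        also have "\<dots> \<le> 2 ^ m * tdeg h"
          using Suc.prems by (intro mult_right_mono power_increasing) auto
        finally show ?thesis using t by simp
      qed
      ultimately show ?case using Lt_square_eq_0[OF \<sigma>] by blast
    qed
    from this[of m] show ?thesis by simp
  qed
  then show ?thesis by blast
qed

text \<open>A monomial is the square of a monomial times one of finitely many monomials.  Hence
  multiplication by a monomial of degree \<open>k\<close> raises the truncation level needed to see \<open>f\<close> in the support
  by \<open>k\<close> plus a constant, and not by the \<open>2k\<close> of the general ideal property.\<close>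
lemma mon_mult_supp_in_qmod_t:
  fixes g :: "'n::finite mpoly list"
  assumes f: "f \<in> supp_qm (qmod g)"
  obtains t0 where "\<And>m t. t0 + mdeg m \<le> t \<Longrightarrow> mon m * f \<in> qmod_t g t \<and> - (mon m * f) \<in> qmod_t g t"
proof -
  let ?G = "{m :: 'n \<Rightarrow>\<^sub>0 nat. mdeg m \<le> card (UNIV :: 'n set)}"
  have "\<exists>t. mon m * f \<in> qmod_t g t \<and> - (mon m * f) \<in> qmod_t g t" for m
  proof -
    have "mon m * f \<in> supp_qm (qmod g)" by (rule ideal_mult_left[OF is_ideal_supp_qmod f])
    then obtain t1 t2 where "mon m * f \<in> qmod_t g t1" "- (mon m * f) \<in> qmod_t g t2"
      by (auto simp: supp_qm_def qmod_def)
    then have "mon m * f \<in> qmod_t g (t1 + t2) \<and> - (mon m * f) \<in> qmod_t g (t1 + t2)"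
      using qmod_t_mono[of t1 "t1 + t2" g] qmod_t_mono[of t2 "t1 + t2" g] by auto
    then show ?thesis by blast
  qed
  then obtain T where T: "mon m * f \<in> qmod_t g (T m)" "- (mon m * f) \<in> qmod_t g (T m)" for m
    by metis
  define t0 where "t0 = sum T ?G"
  have T_le: "T m \<le> t0" if "m \<in> ?G" for m
    unfolding t0_def using that finite_mdeg_le by (intro member_le_sum) auto
  have "mon m * f \<in> qmod_t g t \<and> - (mon m * f) \<in> qmod_t g t" if t: "t0 + mdeg m \<le> t" for m t
  proof -
    define b c where "b = Abs_poly_mapping (\<lambda>i. Poly_Mapping.lookup m i div 2)"
      and "c = Abs_poly_mapping (\<lambda>i. Poly_Mapping.lookup m i mod 2)"
    have lookup: "Poly_Mapping.lookup b i = Poly_Mapping.lookup m i div 2"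
        "Poly_Mapping.lookup c i = Poly_Mapping.lookup m i mod 2" for i
      unfolding b_def c_def by simp_all
    have m: "m = b + b + c"
      by (rule poly_mapping_eqI) (simp add: lookup lookup_add flip: mult_2)
    have "mdeg c \<le> (\<Sum>i\<in>(UNIV :: 'n set). 1)"
      unfolding mdeg_UNIV by (rule sum_mono) (simp add: lookup)
    then have "c \<in> ?G" by simp
    have sq: "tdeg (mon b * mon b) \<le> mdeg m"
      using tdeg_single_le[of "b + b" 1] by (simp add: m mdeg_add mult_single)
    have le: "T c + mdeg m \<le> t" using T_le[OF \<open>c \<in> ?G\<close>] t by simp
    have "mon b * mon b * (mon c * f) \<in> qmod_t g t" "mon b * mon b * - (mon c * f) \<in> qmod_t g t"
      using qmod_t_mult_square[OF T(1) sq] qmod_t_mult_square[OF T(2) sq] qmod_t_mono[OF le, of g]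
      by blast+
    moreover have "mon b * mon b * (mon c * f) = mon m * f"
      by (simp add: m mon_add mult_ac del: mult_single)
    ultimately show ?thesis by simp
  qed
  then show thesis by (rule that)
qed

lemma monic_relation:
  fixes x :: "'n::finite mpoly"
  assumes u: "u \<noteq> 0"
  shows "mconst (1 / lead_coeff u) * mc.peval x u =
    x ^ degree u + (\<Sum>l<degree u. mconst (coeff u l / lead_coeff u) * x ^ l)"
proof -
  \<comment> \<open>No nonzero coefficient is lost under \<open>mconst\<close>, so mapping preserves
    the degree.\<close>
  have "mconst c \<noteq> (0 :: 'n mpoly)" if "c \<noteq> 0" for c
    using that meval_mconst[of c] by (metis meval_0)
  then have "mc.peval x u = (\<Sum>l\<le>degree u. mconst (coeff u l) * x ^ l)"
    unfolding mc.peval_def poly_altdef by (subst degree_map_poly) (auto simp: coeff_map_poly)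
  then show ?thesis
    using u by (simp add: sum_distrib_left distrib_left mult.assoc[symmetric] add.commute
        flip: lessThan_Suc_atMost mconst_mult)
qed

subsection \<open>Remainders of interpolation\<close>

definition interp_rem :: "(('n \<Rightarrow> real) \<Rightarrow> 'n mpoly) \<Rightarrow> ('n \<Rightarrow> real) set \<Rightarrow> 'n mpoly \<Rightarrow> 'n mpoly" where
  "interp_rem u S p = p - (\<Sum>\<xi>\<in>S. mconst (meval p \<xi>) * u \<xi>)"

lemma interp_rem_0: "interp_rem u S 0 = 0"
  by (simp add: interp_rem_def)

lemma interp_rem_add: "interp_rem u S (p + q) = interp_rem u S p + interp_rem u S q"
  by (simp add: interp_rem_def mconst_add sum.distrib algebra_simps)

lemma interp_rem_mconst_mult:
  "interp_rem u S (mconst c * p) = mconst c * interp_rem u S (p :: 'n::finite mpoly)"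
  by (simp add: interp_rem_def mconst_mult right_diff_distrib sum_distrib_left mult.assoc)

lemma interp_rem_sum: "interp_rem u S (sum f A) = (\<Sum>a\<in>A. interp_rem u S (f a))"
  by (induction A rule: infinite_finite_induct) (simp_all add: interp_rem_0 interp_rem_add)

lemma interp_rem_vanishing: "(\<And>\<xi>. \<xi> \<in> S \<Longrightarrow> meval p \<xi> = 0) \<Longrightarrow> interp_rem u S p = p"
  by (simp add: interp_rem_def)

lemma meval_interp_rem:
  fixes S :: "('n::finite \<Rightarrow> real) set"
  assumes "finite S" "\<zeta> \<in> S" "\<And>\<xi>. meval (u \<xi>) \<zeta> = (if \<zeta> = \<xi> then 1 else 0)"
  shows "meval (interp_rem u S p) \<zeta> = 0"
  using assms by (simp add: interp_rem_def if_distrib[of "\<lambda>c. _ * c"] cong: if_cong)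

lemma tdeg_interp_rem_le:
  fixes u :: "('n::finite \<Rightarrow> real) \<Rightarrow> 'n mpoly"
  assumes "tdeg p \<le> t" "\<And>\<xi>. tdeg (u \<xi>) \<le> t"
  shows "tdeg (interp_rem u S p) \<le> t"
  unfolding interp_rem_def
  using assms by (intro tdeg_diff_le tdeg_sum_le tdeg_mconst_mult_le)

subsection \<open>Exactness of the truncated functionals\<close>

text \<open>Strong induction on the degree of the monomial.  Below the fixed bound \<open>D\<close> there are finitely
  many monomials, whose remainders are nilpotent modulo the support.  Above it, the monic
  univariate elements of the support rewrite the monomial into ones of lower degree.\<close>
lemma Lt_interp_rem_mon_eq_0:
  fixes g :: "'n::finite mpoly list"
  defines "S \<equiv> semialg g"
  assumes dim: "krull_dim_quot_zero (supp_qm (qmod g))"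
    and deg_u: "\<And>\<xi>. tdeg (u \<xi>) \<le> \<tau>"
    and u: "\<And>\<xi> \<zeta>. \<zeta> \<in> S \<Longrightarrow> meval (u \<xi>) \<zeta> = (if \<zeta> = \<xi> then 1 else 0)"
  shows "\<exists>d0. \<forall>t \<sigma> m. \<sigma> \<in> Lt g t \<longrightarrow> d0 + mdeg m \<le> t \<longrightarrow> \<sigma> (interp_rem u S (mon m)) = 0"
proof -
  let ?I = "supp_qm (qmod g)" and ?N = "interp_rem u S"
  note id = is_ideal_supp_qmod[of g]
  have S: "finite S" unfolding S_def by (rule finite_semialg[OF dim])
  obtain w where w: "w i \<noteq> 0" "mc.peval (mvar i) (w i) \<in> ?I" for i
    using univariate_in_supp[OF dim, of "mvar _"] by metis
  define n where "n i = degree (w i)" for i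
  define c where "c i l = coeff (w i) l / lead_coeff (w i)" for i l
  define U where "U i = mconst (1 / lead_coeff (w i)) * mc.peval (mvar i) (w i)" for i
  have U_supp: "U i \<in> ?I" for i
    unfolding U_def by (rule ideal_mult_left[OF id w(2)])
  have U_eq: "U i = mvar i ^ n i + (\<Sum>l<n i. mconst (c i l) * mvar i ^ l)" for i
    unfolding U_def n_def c_def by (rule monic_relation[OF w(1)])
  \<comment> \<open>A monomial of degree above \<open>D\<close> has some exponent larger than
    \<open>n i\<close>, so the relation \<open>U i\<close> applies to it.\<close>
  define D where "D = (\<Sum>i\<in>UNIV. n i)"
  have "\<exists>t0. \<forall>t\<ge>t0. \<forall>\<sigma>\<in>Lt g t. \<sigma> (?N (mon m)) = 0" for m
  proof -
    have "meval (?N (mon m)) x = 0" if "x \<in> semialg g" for x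
      using that u by (intro meval_interp_rem S) (auto simp: S_def)
    from vanishing_power_in_supp[OF dim this] obtain k where "?N (mon m) ^ k \<in> ?I" by blast
    then show ?thesis by (rule Lt_eq_0_if_power_in_supp)
  qed
  then obtain T where T: "\<sigma> (?N (mon m)) = 0" if "T m \<le> t" "\<sigma> \<in> Lt g t" for m t \<sigma>
    by metis
  \<comment> \<open>A sum of naturals bounds each of its terms, which gives one level for the
    finitely many monomials.\<close>
  define d1 where "d1 = (\<Sum>m\<in>{m. mdeg m \<le> D}. T m)"
  have T_le: "T m \<le> d1" if "mdeg m \<le> D" for m
    unfolding d1_def using that finite_mdeg_le by (intro member_le_sum) auto
  have "\<exists>t0. \<forall>m t. t0 + mdeg m \<le> t \<longrightarrow> mon m * U i \<in> qmod_t g t \<and> - (mon m * U i) \<in> qmod_t g t" for i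
    using mon_mult_supp_in_qmod_t[OF U_supp[of i]] by metis
  then obtain V where V: "mon m * U i \<in> qmod_t g t" "- (mon m * U i) \<in> qmod_t g t"
    if "V i + mdeg m \<le> t" for i m t by metis
  define d2 where "d2 = (\<Sum>i\<in>UNIV. V i + tdeg (U i))"
  have V_le: "V i + tdeg (U i) \<le> d2" for i
    unfolding d2_def by (rule member_le_sum) auto
  have "\<sigma> (?N (mon m)) = 0" if \<sigma>: "\<sigma> \<in> Lt g t" and t: "d1 + d2 + \<tau> + mdeg m \<le> t" for t \<sigma> m
    using t
  proof (induction "mdeg m" arbitrary: m rule: less_induct)
    case less
    show ?case
    proof (cases "mdeg m \<le> D")
      case True
      then show ?thesis using T[of m t \<sigma>] T_le[of m] \<sigma> less.prems by simp
    next
      case False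
      then obtain i where i: "n i < Poly_Mapping.lookup m i"
        unfolding D_def mdeg_UNIV by (meson not_le sum_mono)
      define m' where "m' = m - Poly_Mapping.single i (n i)"
      have m: "m = m' + Poly_Mapping.single i (n i)"
        by (rule poly_mapping_eqI)
          (use i in \<open>auto simp: m'_def lookup_add lookup_minus lookup_single when_def\<close>)
      have deg_m: "mdeg m = mdeg m' + n i" by (simp add: m mdeg_add)
      let ?r = "\<lambda>l. m' + Poly_Mapping.single i l"
      have "mon m = mon m' * U i - (\<Sum>l<n i. mconst (c i l) * mon (?r l))"
        unfolding m U_eq mon_add mon_single_eq_power
        by (simp add: distrib_left sum_distrib_left mult_ac)
      then have "?N (mon m) + (\<Sum>l<n i. mconst (c i l) * ?N (mon (?r l))) = ?N (mon m' * U i)"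
        by (simp add: flip: interp_rem_mconst_mult interp_rem_sum interp_rem_add)
      \<comment> \<open>Support elements vanish on \<open>S\<close> and equal their own
        remainder.\<close>
      also have "\<dots> = mon m' * U i"
        using supp_vanishes[OF U_supp] by (intro interp_rem_vanishing) (simp add: S_def)
      finally have N: "?N (mon m) = mon m' * U i - (\<Sum>l<n i. mconst (c i l) * ?N (mon (?r l)))"
        by (simp add: algebra_simps)
      have deg_r: "tdeg (mon (?r l)) \<le> t" if "l < n i" for l
        using that less.prems deg_m tdeg_single_le[of "?r l" 1] by (simp add: mdeg_add)
      have deg_u': "tdeg (u \<xi>) \<le> t" for \<xi> using deg_u[of \<xi>] less.prems by simp
      have deg_Nr: "tdeg (?N (mon (?r l))) \<le> t" if "l < n i" for l
        using deg_r[OF that] deg_u' by (rule tdeg_interp_rem_le)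
      have deg_U: "tdeg (mon m' * U i) \<le> t"
        using less.prems deg_m V_le[of i]
        by (intro tdeg_mult_le'[OF tdeg_single_le[of m' 1] order_refl]) simp
      \<comment> \<open>The level needed exceeds the degree of \<open>m'\<close> by a constant only,
        so the offset does not depend on the monomial.\<close>
      have "V i + mdeg m' \<le> t" using less.prems deg_m V_le[of i] by simp
      then have "\<sigma> (mon m' * U i) = 0" by (intro Lt_eq_0[OF \<sigma>] V deg_U)
      moreover have "\<sigma> (\<Sum>l<n i. mconst (c i l) * ?N (mon (?r l))) = 0"
      proof -
        have "\<sigma> (?N (mon (?r l))) = 0" if "l < n i" for l
          using that less.prems deg_m by (intro less.hyps) (simp_all add: mdeg_add)
        then show ?thesis
          using deg_Nr by (subst Lt_sum[OF \<sigma>]) (auto simp: Lt_mconst_mult[OF \<sigma>] intro: tdeg_mconst_mult_le)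
      qed
      moreover have "tdeg (\<Sum>l<n i. mconst (c i l) * ?N (mon (?r l))) \<le> t"
        using deg_Nr by (intro tdeg_sum_le tdeg_mconst_mult_le) auto
      ultimately show ?thesis unfolding N using Lt_diff[OF \<sigma> deg_U] by simp
    qed
  qed
  then show ?thesis by blast
qed

text \<open>By linearity the vanishing on remainders of monomials extends to all \<open>p\<close>.
  The offset \<open>d0\<close> does not depend on \<open>p\<close>, which lets one \<open>d\<close>
  serve all \<open>k\<close>.\<close>

lemma Lt_eq_interpolation:
  fixes g :: "'n::finite mpoly list"
  defines "S \<equiv> semialg g"
  assumes dim: "krull_dim_quot_zero (supp_qm (qmod g))"
    and deg_u: "\<And>\<xi>. tdeg (u \<xi>) \<le> \<tau>"
    and u: "\<And>\<xi> \<zeta>. \<zeta> \<in> S \<Longrightarrow> meval (u \<xi>) \<zeta> = (if \<zeta> = \<xi> then 1 else 0)"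
  shows "\<exists>d0. \<forall>t \<sigma> p. \<sigma> \<in> Lt g t \<longrightarrow> d0 + tdeg p \<le> t \<longrightarrow> \<sigma> p = (\<Sum>\<xi>\<in>S. meval p \<xi> * \<sigma> (u \<xi>))"
proof -
  let ?N = "interp_rem u S"
  obtain d0 where d0: "\<sigma> (?N (mon m)) = 0" if "\<sigma> \<in> Lt g t" "d0 + mdeg m \<le> t" for t \<sigma> m
    using Lt_interp_rem_mon_eq_0[OF dim deg_u u[unfolded S_def]] unfolding S_def by metis
  have "\<sigma> p = (\<Sum>\<xi>\<in>S. meval p \<xi> * \<sigma> (u \<xi>))"
    if \<sigma>: "\<sigma> \<in> Lt g t" and t: "d0 + \<tau> + tdeg p \<le> t" for t \<sigma> p
  proof -
    have keys: "mdeg m \<le> tdeg p" if "m \<in> Poly_Mapping.keys p" for m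
      using that by (rule mdeg_le_tdeg)
    have deg_u': "tdeg (u \<xi>) \<le> t" for \<xi> using deg_u[of \<xi>] t by simp
    have deg_N: "tdeg (?N (mon m)) \<le> t" if "m \<in> Poly_Mapping.keys p" for m
      using keys[OF that] t tdeg_single_le[of m 1] deg_u' by (intro tdeg_interp_rem_le) auto
    have zero: "\<sigma> (?N (mon m)) = 0" if "m \<in> Poly_Mapping.keys p" for m
      using keys[OF that] t by (intro d0[OF \<sigma>]) simp
    have "?N p = (\<Sum>m\<in>Poly_Mapping.keys p. mconst (Poly_Mapping.lookup p m) * ?N (mon m))"
      by (subst mpoly_eq_sum_mon[of p]) (simp only: interp_rem_sum interp_rem_mconst_mult)
    also have "\<sigma> \<dots> = (\<Sum>m\<in>Poly_Mapping.keys p. Poly_Mapping.lookup p m * \<sigma> (?N (mon m)))"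
      using deg_N by (subst Lt_sum[OF \<sigma>]) (auto simp: Lt_mconst_mult[OF \<sigma>] intro: tdeg_mconst_mult_le)
    also have "\<dots> = 0" using zero by simp
    finally have "\<sigma> (p - (\<Sum>\<xi>\<in>S. mconst (meval p \<xi>) * u \<xi>)) = 0" by (simp add: interp_rem_def)
    moreover have "\<sigma> (p - (\<Sum>\<xi>\<in>S. mconst (meval p \<xi>) * u \<xi>)) =
        \<sigma> p - \<sigma> (\<Sum>\<xi>\<in>S. mconst (meval p \<xi>) * u \<xi>)"
      using t deg_u' by (intro Lt_diff[OF \<sigma>] tdeg_sum_le tdeg_mconst_mult_le) auto
    moreover have "\<sigma> (\<Sum>\<xi>\<in>S. mconst (meval p \<xi>) * u \<xi>) = (\<Sum>\<xi>\<in>S. meval p \<xi> * \<sigma> (u \<xi>))"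
      using deg_u' by (subst Lt_sum[OF \<sigma>]) (auto simp: Lt_mconst_mult[OF \<sigma>] intro: tdeg_mconst_mult_le)
    ultimately show ?thesis by simp
  qed
  then show ?thesis by blast
qed

lemma restr_eval_cone_in_Lt:
  fixes g :: "'n::finite mpoly list"
  assumes "\<sigma> \<in> eval_cone (semialg g)"
  shows "restr t \<sigma> \<in> Lt g t"
proof -
  obtain c where c: "\<And>\<xi>. \<xi> \<in> semialg g \<Longrightarrow> 0 \<le> c \<xi>" "\<sigma> = (\<lambda>p. \<Sum>\<xi>\<in>semialg g. c \<xi> * meval p \<xi>)"
    using assms unfolding eval_cone_def by blast
  have "lin_functional_t t (restr t \<sigma>)"
    unfolding lin_functional_t_def
    by (auto simp: restr_def c(2) tdeg_add_le tdeg_mconst_mult_le sum.distrib sum_distrib_left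
        distrib_left mult.left_commute)
  moreover have "0 \<le> restr t \<sigma> q" if "q \<in> qmod_t g t" for q
    using c(1) qmod_nonneg[OF qmodI[OF that]]
    by (auto simp: restr_def c(2) intro!: sum_nonneg mult_nonneg_nonneg)
  ultimately show ?thesis by (simp add: Lt_def)
qed

theorem mainTheorem4:
  fixes g :: "('n::finite) mpoly list"
  assumes "krull_dim_quot_zero (supp_qm (qmod g))"
  shows "semialg g \<noteq> {} \<and> finite (semialg g) \<and>
    (\<exists>d::nat. \<forall>k::nat.
       restr_set (2 * (cm_reg (semialg g) - 1) + k) (Lt g (d + k)) =
       restr_set (2 * (cm_reg (semialg g) - 1) + k) (eval_cone (semialg g)))"
proof -
  define S where "S = semialg g"
  define \<tau> where "\<tau> = interp_deg S"
  have fin: "finite S" unfolding S_def by (rule finite_semialg[OF assms])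
  obtain u where deg_u: "\<And>\<xi>. tdeg (u \<xi>) \<le> \<tau>"
    and u: "\<And>\<xi> \<zeta>. \<zeta> \<in> S \<Longrightarrow> meval (u \<xi>) \<zeta> = (if \<zeta> = \<xi> then 1 else 0)"
    unfolding \<tau>_def using interp_deg_basis[OF fin] by metis
  obtain d0 where d0: "\<sigma> p = (\<Sum>\<xi>\<in>S. meval p \<xi> * \<sigma> (u \<xi>))"
    if "\<sigma> \<in> Lt g t" "d0 + tdeg p \<le> t" for t \<sigma> p
    using Lt_eq_interpolation[OF assms deg_u u[unfolded S_def]] unfolding S_def by metis
  \<comment> \<open>Here \<open>\<tau>\<close> is the regularity minus 1. The level leaves the
    offset \<open>d0\<close> above every degree up to \<open>2 * \<tau> + k\<close>.\<close>
  have "restr_set (2 * \<tau> + k) (Lt g (d0 + 2 * \<tau> + k)) = restr_set (2 * \<tau> + k) (eval_cone S)" for k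
    unfolding restr_set_def
  proof (intro equalityI image_subsetI)
    fix \<sigma> assume \<sigma>: "\<sigma> \<in> Lt g (d0 + 2 * \<tau> + k)"
    have "0 \<le> \<sigma> (u \<xi>)" if "\<xi> \<in> S" for \<xi>
    proof -
      \<comment> \<open>The representation formula has to reach the square of \<open>u \<xi>\<close>
        even for \<open>k = 0\<close>, hence the degree \<open>2 * \<tau>\<close>.\<close>
      have deg: "tdeg (u \<xi> * u \<xi>) \<le> 2 * \<tau>"
        using deg_u by (intro tdeg_mult_le'[where a = \<tau> and b = \<tau>]) auto
      then have "0 \<le> \<sigma> (u \<xi> * u \<xi>)"
        by (intro Lt_nonneg[OF \<sigma>] square_in_qmod_t) simp
      also have "\<dots> = (\<Sum>\<zeta>\<in>S. meval (u \<xi> * u \<xi>) \<zeta> * \<sigma> (u \<zeta>))"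
        using deg by (intro d0[OF \<sigma>]) simp
      also have "\<dots> = (\<Sum>\<zeta>\<in>S. if \<zeta> = \<xi> then \<sigma> (u \<xi>) else 0)"
        using u by (intro sum.cong) auto
      finally show ?thesis using fin that by simp
    qed
    then have "(\<lambda>p. \<Sum>\<xi>\<in>S. \<sigma> (u \<xi>) * meval p \<xi>) \<in> eval_cone S"
      unfolding eval_cone_def mem_Collect_eq by (intro exI[of _ "\<lambda>\<xi>. \<sigma> (u \<xi>)"]) simp
    moreover have "restr (2 * \<tau> + k) \<sigma> = restr (2 * \<tau> + k) (\<lambda>p. \<Sum>\<xi>\<in>S. \<sigma> (u \<xi>) * meval p \<xi>)"
      by (rule ext) (simp add: restr_def d0[OF \<sigma>] mult.commute)
    ultimately show "restr (2 * \<tau> + k) \<sigma> \<in> restr (2 * \<tau> + k) ` eval_cone S" by blast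
  next
    fix \<sigma> assume "\<sigma> \<in> eval_cone S"
    \<comment> \<open>A cone element is cut to the larger level first, since functionals in
      \<open>Lt\<close> must vanish above their level.\<close>
    then have "restr (d0 + 2 * \<tau> + k) \<sigma> \<in> Lt g (d0 + 2 * \<tau> + k)"
      unfolding S_def by (rule restr_eval_cone_in_Lt)
    moreover have "restr (2 * \<tau> + k) \<sigma> = restr (2 * \<tau> + k) (restr (d0 + 2 * \<tau> + k) \<sigma>)"
      by (rule ext) (simp add: restr_def)
    ultimately show "restr (2 * \<tau> + k) \<sigma> \<in> restr (2 * \<tau> + k) ` Lt g (d0 + 2 * \<tau> + k)" by blast
  qed
  then show ?thesis
    using semialg_nonempty[OF assms] fin unfolding cm_reg_def S_def \<tau>_def
    by (intro conjI exI[of _ "d0 + 2 * interp_deg (semialg g)"]) auto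
qed

end
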